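(* Let $\mu,\nu\in\mathbb{R}$ with $\mu\in(-\frac12,\frac12)$ and $|\nu|\in(|\mu|,\mu+1)$. Then, apart from the branch point $z=0$, the Lommel function $s_{\mu,\nu}(z)$ possesses only real zeros. These zeros are simple, the non-negative ones (other than the branch point $z=0$) are all contained in the intervals $(k\pi,(k+1)\pi)$, $k=1,2,\ldots$, and each of these intervals contains exactly one zero.
   Context: When neither $\mu+\nu$ nor $\mu-\nu$ is an odd negative integer, the Lommel function is $$s_{\mu,\nu}(z)=z^{\mu+1}\sum_{k=0}^\infty \frac{(-1)^k z^{2k}}{\prod_{j=0}^{k}\left((\mu+2j+1)^2-\nu^2\right)}=\frac{z^{\mu+1}}{(\mu+1)^2-\nu^2}\,{}_1F_2\left(1;\tfrac{\mu-\nu+3}{2},\tfrac{\mu+\nu+3}{2};-\tfrac{z^2}{4}\right),$$ a solution of $z^2y''+zy'+(z^2-\nu^2)y=z^{\mu+1}$. The function $z^{-\mu-1}s_{\mu,\nu}(z)$ is an even entire function of $z$, so the zeros of $s_{\mu,\nu}$ in $\mathbb{C}\setminus\{0\}$ (and their multiplicities) do not depend on the branch chosen for $z^{\mu+1}$. *)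

theory Defs
  imports "HOL-Complex_Analysis.Complex_Analysis"
begin

(* An arbitrary pointwise choice of logarithm on the punctured plane; no continuity is
   required, so that the principal branch Ln is an instance, as is, for every non-zero point,
   some choice that is analytic at that point. *)
definition log_choice :: "(complex \<Rightarrow> complex) \<Rightarrow> bool" where
  "log_choice L \<longleftrightarrow> (\<forall>z. z \<noteq> 0 \<longrightarrow> exp (L z) = z)"

(* The power z^(mu+1) is read as exp ((mu+1) * L z), where L is the chosen logarithm;
   L = Ln gives z powr (mu+1) for z \<noteq> 0.  The value at the branch point z = 0 is
   meaningless.  The intended parameters are those for which neither mu+nu nor mu-nu is an
   odd negative integer, i.e. for which no factor in the denominators vanishes. *)
definition lommel :: "(complex \<Rightarrow> complex) \<Rightarrow> real \<Rightarrow> real \<Rightarrow> complex \<Rightarrow> complex" where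
  "lommel L \<mu> \<nu> z =
     exp (of_real (\<mu> + 1) * L z) *
     (\<Sum>k. (-1) ^ k * z ^ (2 * k) /
           of_real (\<Prod>j=0..k. (\<mu> + 2 * real j + 1)\<^sup>2 - \<nu>\<^sup>2))"

end

theory Submission
  imports Defs "HOL-Real_Asymp.Real_Asymp"
begin

text \<open>
  Write $s_{\mu,\nu}(z) = z^{\mu+1} E(z)$ with \<open>E\<close> the even entire function \<open>lommel_entire\<close>; as only
  $\nu^2$ enters, let $\nu \ge 0$.  The zeros of $s_{\mu,\nu}$ away from the origin are those of \<open>E\<close>.
  The proof makes an idea of Polya on sine transforms of increasing densities explicit and combines it
  with partial fractions.

  Put $a = \frac{\mu+\nu}2$, $b = \frac{\mu-\nu}2$, $c = \mu + \frac12$ and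
  $\varphi(u) = {}_2F_1(a,b;c;u)$.  Then, up to a positive constant,
  \[ z E(z) = \int_0^1 h(u) \frac{\sin(z\sqrt{1-u})}{\sqrt{1-u}}\,du, \qquad
      h(u) = u^{c-1} \varphi(u), \]
  because the moments $\int_0^1 h(u) (1-u)^k du$ are Beta values times values of Gauss's series at $1$,
  and the contiguous relation (\<open>gauss_sum_contiguous\<close>) gives them the same two-term recursion as the
  coefficients of the Lommel series (\<open>reciprocal_den\<close>).  The hypotheses on the parameters say that
  $a > 0$ and $-1 < b < 0$, so all coefficients of $\varphi$ but the first are negative, and $c < 1$;
  hence \<open>h\<close> is strictly decreasing.  It is positive because $\varphi(1) > 0$ (\<open>gauss_sum_pos\<close>).

  Monotonicity yields $(-1)^{k+1} E(k\pi) > 0$ for $k \ge 1$ (\<open>real_transform_sign\<close>), and the integral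
  representation yields $|E(w)| \le K e^{|\mathrm{Im}\,w|}$.  By the second property the residue theorem
  on large circles gives (\<open>partial_fractions_over_sine\<close>)
  \[ \frac{z E(z)}{\sin z} = E(0) + \sum_{k\ge1} A_k \frac{z^2}{k^2\pi^2 - z^2},
      \qquad A_k = 2 (-1)^{k+1} E(k\pi), \]
  and by the first all $A_k$ are positive.  The right-hand side is a function of $z^2$ whose imaginary
  part has the strict sign of $\mathrm{Im}\,z^2$, so $z^2$ is real at every zero; the power series of
  \<open>E\<close> is positive on the imaginary axis, so \<open>z\<close> is real.  On the positive axis the right-hand side
  is positive on $(0,\pi)$ and strictly increasing between consecutive poles, which gives at most one
  zero in each $(k\pi,(k+1)\pi)$ and its simplicity; the alternating signs give existence.
\<close>

section \<open>Gauss's hypergeometric series at the argument one\<close>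

text \<open>
  The coefficients of Gauss's hypergeometric series $_2F_1(a,b;c;\cdot)$.
\<close>
definition hyp_coeff :: "real \<Rightarrow> real \<Rightarrow> real \<Rightarrow> nat \<Rightarrow> real" where
  "hyp_coeff a b c n = pochhammer a n * pochhammer b n / (pochhammer c n * fact n)"

lemma hyp_coeff_0 [simp]: "hyp_coeff a b c 0 = 1"
  by (simp add: hyp_coeff_def)

lemma hyp_coeff_Suc:
  assumes "c > 0"
  shows "hyp_coeff a b c (Suc n) = hyp_coeff a b c n * ((a + n) * (b + n) / ((c + n) * (n + 1)))"
  using assms by (simp add: hyp_coeff_def pochhammer_Suc field_simps)

lemma hyp_coeff_shift:
  assumes "c > 0"
  shows "hyp_coeff a b (c + 1) n = hyp_coeff a b c n * (c / (c + n))"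
proof (induction n)
  case (Suc n)
  have "(c / d) * (p / ((d + 1) * m)) = (p / (d * m)) * (c / (d + 1))" for d p m :: real
    by (simp add: mult_ac)
  note algebra = this[of "c + n" "(a + n) * (b + n)" "n + 1"]
  have "hyp_coeff a b (c + 1) (Suc n)
      = hyp_coeff a b c n * ((c / (c + n)) * ((a + n) * (b + n) / ((c + n + 1) * (n + 1))))"
    using hyp_coeff_Suc[of "c + 1" a b n] assms
    by (simp only: Suc.IH mult.assoc add.assoc add.commute[of 1])
  also have "\<dots> = hyp_coeff a b c (Suc n) * (c / (c + Suc n))"
    unfolding algebra hyp_coeff_Suc[OF assms] by (simp only: mult.assoc of_nat_Suc add_ac)
  finally show ?case .
qed (use assms in auto)

lemma hyp_coeff_neg:
  assumes "a > 0" "-1 < b" "b < 0" "c > 0" "n > 0"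
  shows "hyp_coeff a b c n < 0"
proof -
  obtain m where n: "n = Suc m" using assms(5) by (cases n) auto
  have "pochhammer b n < 0"
    unfolding n pochhammer_rec using assms by (intro mult_neg_pos pochhammer_pos) auto
  moreover have "pochhammer a n > 0" "pochhammer c n > 0"
    using assms by (auto intro: pochhammer_pos)
  ultimately show ?thesis
    by (auto simp: hyp_coeff_def divide_less_0_iff mult_less_0_iff zero_less_mult_iff)
qed

text \<open>
  The telescoping identity behind Gauss's contiguous relation at the argument $1$.  It is used
  three times: for convergence, for the vanishing of the boundary term \<open>n * hyp_coeff a b c n\<close>,
  and for the relation itself.
\<close>
lemma hyp_coeff_telescope:
  assumes "c > 0"
  shows "real (Suc n) * hyp_coeff a b c (Suc n) - real n * hyp_coeff a b c n
       = hyp_coeff a b c n * ((a * b - n * (c - a - b)) / (c + n))"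
proof -
  have pos: "c + real n > 0" using assms by simp
  have "real (Suc n) * hyp_coeff a b c (Suc n) = hyp_coeff a b c n * ((a + n) * (b + n) / (c + n))"
    unfolding hyp_coeff_Suc[OF assms] by simp
  moreover have "(a + n) * (b + n) / (c + n) - n = (a * b - n * (c - a - b)) / (c + n)"
    using pos by (simp add: divide_simps) (simp add: algebra_simps)
  ultimately show ?thesis by (metis mult.commute right_diff_distrib)
qed

text \<open>
  At the argument $1$ the ratio test is inconclusive.  All coefficients after the first are negative,
  so the telescoping identity makes \<open>n * hyp_coeff a b c n\<close> increasing and bounded above by $0$, hence
  convergent.  Its increments are eventually at least a positive multiple of the absolute value of the
  coefficient, which gives summability; and a nonzero limit would make the coefficients comparable to
  the harmonic series.
\<close>
lemma hyp_coeff_summable_and_limit: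
  assumes a: "a > 0" and b: "-1 < b" "b < 0" and c: "c > 0" and e: "c - a - b > 0"
  shows "summable (hyp_coeff a b c)" and "(\<lambda>n. real n * hyp_coeff a b c n) \<longlonglongrightarrow> 0"
proof -
  let ?t = "hyp_coeff a b c"
  \<comment> \<open>\<open>q\<close> is the ratio of the increment of \<open>s\<close> to the absolute value of the coefficient; it tends
    to the excess \<open>c - a - b\<close>.\<close>
  define s where "s n = real n * ?t n" for n
  define q where "q n = (n * (c - a - b) - a * b) / (c + real n)" for n :: nat
  have neg: "?t n < 0" if "n > 0" for n using hyp_coeff_neg[OF a b c that] .
  have step: "s (Suc n) - s n = - ?t n * q n" for n
    unfolding s_def q_def hyp_coeff_telescope[OF c] by (simp add: field_simps)
  have qnn: "q n \<ge> 0" for n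
    unfolding q_def using a b c e by (intro divide_nonneg_pos add_nonneg_nonneg)
       (auto simp: mult_le_0_iff intro: order_trans[of "a*b" 0])
  have s_mono: "s (Suc n) \<le> s (Suc (Suc n))" for n
    using step[of "Suc n"] qnn[of "Suc n"] neg[of "Suc n"]
    by (smt (verit) mult_nonneg_nonneg zero_less_Suc)
  have "incseq (\<lambda>n. s (Suc n))" using s_mono by (rule incseq_SucI)
  moreover have s_le: "s (Suc n) \<le> 0" for n
    unfolding s_def using neg[of "Suc n"] by (intro mult_nonneg_nonpos) auto
  ultimately obtain l where l: "(\<lambda>n. s (Suc n)) \<longlonglongrightarrow> l" and lub: "\<And>n. s (Suc n) \<le> l"
    using incseq_convergent[of "\<lambda>n. s (Suc n)" 0] by blast
  have l0: "l \<le> 0" by (rule LIMSEQ_le_const2[OF l]) (use s_le in auto)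
  have s_lim: "s \<longlonglongrightarrow> l" using l by (simp add: filterlim_sequentially_Suc)
  have "(\<lambda>n. s (Suc n) - s n) sums (l - s 0)"
    using telescope_sums[OF s_lim] .
  then have sumq: "summable (\<lambda>n. - ?t n * q n)" by (simp add: step sums_iff)
  have "q \<longlonglongrightarrow> c - a - b"
    unfolding q_def using c by real_asymp
  then have "eventually (\<lambda>n. q n > (c - a - b) / 2) sequentially"
    using e by (intro order_tendstoD) auto
  then have "eventually (\<lambda>n. norm (?t n) \<le> (2 / (c - a - b)) * (- ?t n * q n)) sequentially"
    using eventually_gt_at_top[of 0]
  proof eventually_elim
    case (elim n)
    then have "(- ?t n) * ((c - a - b) / 2) \<le> (- ?t n) * q n"
      using neg[of n] by (intro mult_left_mono) auto
    then have "- ?t n \<le> (2 / (c - a - b)) * (- ?t n * q n)" using e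
      by (simp add: field_simps)
    then show ?case using neg[of n] elim by simp
  qed
  then show summ: "summable ?t"
    by (rule summable_comparison_test_ev) (intro summable_mult sumq)
  have "l = 0"
  proof (rule ccontr)
    assume "l \<noteq> 0" with l0 have l: "l < 0" by simp
    have *: "inverse (real (Suc n)) \<le> ?t (Suc n) / l" for n
      using lub[of n] l by (simp add: s_def field_simps)
    have "summable (\<lambda>n. ?t (Suc n) / l)"
      using summ by (subst (asm) summable_Suc_iff[symmetric]) (rule summable_divide)
    then have "summable (\<lambda>n. inverse (real (Suc n)))"
      by (rule summable_comparison_test[rotated]) (use * in auto)
    then have "summable (\<lambda>n. inverse (real n))" by (subst (asm) summable_Suc_iff)
    then show False using not_summable_harmonic[where 'a=real] by simp
  qed
  with s_lim show "(\<lambda>n. real n * ?t n) \<longlonglongrightarrow> 0" by (simp add: s_def[abs_def])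
qed

text \<open>
  The value $_2F_1(a,b;c;1)$.
\<close>
definition gauss_sum :: "real \<Rightarrow> real \<Rightarrow> real \<Rightarrow> real" where
  "gauss_sum a b c = (\<Sum>n. hyp_coeff a b c n)"

lemma gauss_sum_contiguous:
  assumes a: "a > 0" and b: "-1 < b" "b < 0" and c: "c > 0" and e: "c - a - b > 0"
  shows "(c - a) * (c - b) * gauss_sum a b (c + 1) = c * (c - a - b) * gauss_sum a b c"
proof -
  let ?t = "hyp_coeff a b c"
  have S: "?t sums gauss_sum a b c"
    using hyp_coeff_summable_and_limit(1)[OF assms] by (simp add: gauss_sum_def sums_iff)
  have "hyp_coeff a b (c + 1) sums gauss_sum a b (c + 1)"
    using hyp_coeff_summable_and_limit(1)[OF a b, of "c+1"] c e by (simp add: gauss_sum_def sums_iff)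
  from sums_diff[OF sums_mult[OF this, of "(c - a) * (c - b)"] sums_mult[OF S, of "c * (c - a - b)"]]
  have "(\<lambda>n. (c - a) * (c - b) * hyp_coeff a b (c + 1) n - c * (c - a - b) * ?t n) sums
     ((c - a) * (c - b) * gauss_sum a b (c + 1) - c * (c - a - b) * gauss_sum a b c)" .
  moreover have "(c - a) * (c - b) * hyp_coeff a b (c + 1) n - c * (c - a - b) * ?t n
     = c * (real (Suc n) * ?t (Suc n) - real n * ?t n)" for n
  proof -
    have "c + real n > 0" using c by simp
    then show ?thesis unfolding hyp_coeff_telescope[OF c] hyp_coeff_shift[OF c]
      by (simp add: field_simps)
  qed
  moreover have "(\<lambda>n. c * (real (Suc n) * ?t (Suc n) - real n * ?t n)) sums (c * (0 - real 0 * ?t 0))"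
    by (intro sums_mult telescope_sums hyp_coeff_summable_and_limit(2)[OF assms])
  ultimately show ?thesis using sums_unique2 by fastforce
qed

text \<open>
  As \<open>c\<close> grows by integers, all terms of the series after the leading $1$ shrink at least like
  \<open>c / (c + k)\<close>, so the sum is positive for large shifts.
\<close>
lemma gauss_sum_pos_large:
  assumes a: "a > 0" and b: "-1 < b" "b < 0" and c: "c > 0" and e: "c - a - b > 0"
  shows "\<exists>k. gauss_sum a b (c + real k) > 0"
proof -
  let ?t = "hyp_coeff a b"
  have shift: "?t (c + real k) (Suc n) \<ge> ?t c (Suc n) * (c / (c + real k))" for k n
  proof (induction k)
    case (Suc k)
    have pos: "c + real k > 0" "c + real k + 1 > 0" "c + real k + real (Suc n) > 0" using c by auto
    have neg: "?t (c + real k) (Suc n) < 0" using pos by (intro hyp_coeff_neg a b) auto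
    have "?t c (Suc n) * (c / (c + real (Suc k)))
        = (?t c (Suc n) * (c / (c + real k))) * ((c + k) / (c + k + 1))"
    proof -
      have "(c / (c + real k)) * ((c + k) / (c + k + 1)) = c / (c + real (Suc k))"
        using pos by (simp add: divide_simps) (simp add: algebra_simps)?
      then show ?thesis by (simp only: mult.assoc)
    qed
    also have "\<dots> \<le> ?t (c + real k) (Suc n) * ((c + k) / (c + k + 1))"
      using Suc pos by (intro mult_right_mono) auto
    also have "\<dots> \<le> ?t (c + real k) (Suc n) * ((c + k) / (c + k + Suc n))"
    proof (rule mult_left_mono_neg)
      show "(c + k) / (c + k + Suc n) \<le> (c + k) / (c + k + 1)"
        using pos by (intro divide_left_mono) auto
    qed (use neg in auto)
    also have "\<dots> = ?t (c + real (Suc k)) (Suc n)"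
      using hyp_coeff_shift[OF pos(1), of a b "Suc n"] by (simp add: add_ac)
    finally show ?case .
  qed (use c in auto)
  have summ: "summable (?t (c + real k))" for k
    using hyp_coeff_summable_and_limit(1)[OF a b, of "c + k"] c e by simp
  define r where "r = (\<Sum>n. ?t c (Suc n))"
  have summ0: "summable (\<lambda>n. ?t c (Suc n))" using summ[of 0] by (simp add: summable_Suc_iff)
  have bound: "gauss_sum a b (c + real k) \<ge> 1 + r * (c / (c + k))" for k
  proof -
    have "r * (c / (c + k)) = (\<Sum>n. ?t c (Suc n) * (c / (c + k)))"
      unfolding r_def by (rule suminf_mult2[OF summ0])
    also have "\<dots> \<le> (\<Sum>n. ?t (c + k) (Suc n))"
      using summ[of k] summ0 shift by (intro suminf_le summable_mult2) (auto simp: summable_Suc_iff)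
    also have "\<dots> = gauss_sum a b (c + k) - 1"
      unfolding gauss_sum_def using suminf_split_head[OF summ[of k]] by simp
    finally show ?thesis by simp
  qed
  have "(\<lambda>k. 1 + r * (c / (c + real k))) \<longlonglongrightarrow> 1" by real_asymp
  then have "eventually (\<lambda>k. 1 + r * (c / (c + real k)) > 0) sequentially"
    by (intro order_tendstoD) auto
  then obtain k where "1 + r * (c / (c + real k)) > 0" by (auto simp: eventually_sequentially)
  with bound[of k] show ?thesis by (intro exI[of _ k]) simp
qed

text \<open>
  The contiguous relation has positive factors on both sides, so positivity for large \<open>c\<close> descends
  to every admissible \<open>c\<close>.  This replaces the evaluation of the sum by Gamma functions.
\<close>
lemma gauss_sum_pos:
  assumes a: "a > 0" and b: "-1 < b" "b < 0" and c: "c > 0" and e: "c - a - b > 0" and ca: "c > a"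
  shows "gauss_sum a b c > 0"
proof -
  obtain k where "gauss_sum a b (c + real k) > 0"
    using gauss_sum_pos_large[OF a b c e] by blast
  then show ?thesis
    using c e ca
  proof (induction k arbitrary: c)
    case (Suc k)
    have "gauss_sum a b (c + 1) > 0"
    proof (rule Suc.IH)
      have "c + 1 + real k = c + real (Suc k)" by simp
      then show "gauss_sum a b (c + 1 + real k) > 0" using Suc.prems(1) by (simp only:)
    qed (use Suc.prems in linarith)+
    moreover have pos: "(c - a) * (c - b) > 0" "c * (c - a - b) > 0" using Suc.prems b by auto
    ultimately have "c * (c - a - b) * gauss_sum a b c > 0"
      unfolding gauss_sum_contiguous[OF a b Suc.prems(2,3), symmetric] by simp
    then show ?case using pos(2) by (rule zero_less_mult_pos)
  qed simp
qed

section \<open>A decreasing density and its moments\<close>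

text \<open>
  Multiplying by the Beta integral of $u^{c+n-1}(1-u)^k$ shifts the lower parameter of the
  hypergeometric coefficient; this is why the moments below are again values of Gauss's series.
\<close>
lemma hyp_coeff_times_Beta:
  assumes "c > 0"
  shows "hyp_coeff a b c n * Beta (c + n) (real k + 1) = Beta c (real k + 1) * hyp_coeff a b (c + k + 1) n"
proof (induction n)
  case (Suc n)
  have pos: "c + real n > 0" "c + real k + 1 > 0" "c + k + 1 + n > 0" using assms by auto
  have "c + real n \<notin> \<int>\<^sub>\<le>\<^sub>0" using pos(1) by (auto elim!: nonpos_Ints_cases)
  from Beta_plus1_left[OF this, of "real k + 1"]
  have "(c + k + 1 + n) * Beta (c + Suc n) (real k + 1) = (c + n) * Beta (c + n) (real k + 1)"
    by (simp add: algebra_simps)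
  then have B: "Beta (c + Suc n) (real k + 1) = (c + n) * Beta (c + n) (real k + 1) / (c + k + 1 + n)"
    using pos(3) by (simp add: field_simps)
  have "hyp_coeff a b c (Suc n) * Beta (c + Suc n) (real k + 1)
     = (hyp_coeff a b c n * Beta (c + n) (real k + 1)) * ((a + n) * (b + n) / ((c + k + 1 + n) * (n + 1)))"
    unfolding hyp_coeff_Suc[OF assms] B using pos by (simp add: mult_ac)
  also have "\<dots> = Beta c (real k + 1) * hyp_coeff a b (c + k + 1) (Suc n)"
    unfolding Suc.IH hyp_coeff_Suc[OF pos(2)] by simp
  finally show ?case .
qed simp

lemma Beta_real_pos: "x > 0 \<Longrightarrow> y > 0 \<Longrightarrow> Beta x (y :: real) > 0"
  by (simp add: Beta_def Gamma_real_pos)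

lemma Beta_integral_open_interval:
  fixes x y :: real
  assumes "x > 0" "y > 0"
  shows "integrable (lebesgue_on {0<..<1}) (\<lambda>t. t powr (x - 1) * (1 - t) powr (y - 1))"
    and "integral\<^sup>L (lebesgue_on {0<..<1}) (\<lambda>t. t powr (x - 1) * (1 - t) powr (y - 1)) = Beta x y"
proof -
  let ?f = "\<lambda>t::real. t powr (x - 1) * (1 - t) powr (y - 1)"
  have I: "(?f has_integral Beta x y) {0<..<1}"
    using has_integral_Beta_real[OF assms] by (simp add: has_integral_Icc_iff_Ioo)
  then have "?f absolutely_integrable_on {0<..<1}"
    by (intro nonnegative_absolutely_integrable_1) (auto simp: has_integral_iff)
  then show *: "integrable (lebesgue_on {0<..<1}) ?f"
    by (intro absolutely_integrable_imp_integrable) auto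
  show "integral\<^sup>L (lebesgue_on {0<..<1}) ?f = Beta x y"
    using lebesgue_integral_eq_integral[OF *] I by (simp add: integral_unique)
qed

text \<open>
  The density \<open>h\<close> on the unit interval whose sine transform is the Lommel function.  It is kept in
  the variable $u = 1 - t^2$, where $t$ is the variable of the sine transform, because its moments
  are then plain Beta integrals and no substitution is needed anywhere.
\<close>
locale gauss_density =
  fixes a b c :: real
  assumes a: "a > 0" and b: "-1 < b" "b < 0" and c: "0 < c" "c < 1"
    and excess: "c - a - b > 0" and c_gt_a: "c > a"
begin

abbreviation M :: "real measure" where "M \<equiv> lebesgue_on {0<..<1}"

definition phi :: "real \<Rightarrow> real" where "phi u = (\<Sum>n. hyp_coeff a b c n * u ^ n)"
definition h :: "real \<Rightarrow> real" where "h u = u powr (c - 1) * phi u"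
text \<open>
  The closed form of $\int_0^1 h(u)(1-u)^k\,du$, see \<open>h_moment\<close>.
\<close>
definition moment :: "nat \<Rightarrow> real" where "moment k = Beta c (real k + 1) * gauss_sum a b (c + k + 1)"

lemma shifted: "c + real k + 1 > 0" "c + real k + 1 - a - b > 0" "c + real k + 1 > a"
  using c excess c_gt_a by auto

lemma coeff_nonpos: "n > 0 \<Longrightarrow> hyp_coeff a b c n \<le> 0"
  using hyp_coeff_neg[OF a b c(1)] by (simp add: less_imp_le)

lemma summable_abs_hyp_coeff:
  assumes "d > 0" "d - a - b > 0"
  shows "summable (\<lambda>n. \<bar>hyp_coeff a b d n\<bar>)"
proof -
  have "summable (\<lambda>n. - hyp_coeff a b d n)"
    using hyp_coeff_summable_and_limit(1)[OF a b assms] by (rule summable_minus)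
  moreover have "eventually (\<lambda>n. norm \<bar>hyp_coeff a b d n\<bar> \<le> - hyp_coeff a b d n) sequentially"
    using eventually_gt_at_top[of 0]
    by eventually_elim (use hyp_coeff_neg[OF a b assms(1)] in \<open>simp add: less_imp_le\<close>)
  ultimately show ?thesis by (rule summable_comparison_test_ev[rotated])
qed

lemma summable_phi:
  assumes "0 \<le> u" "u \<le> 1"
  shows "summable (\<lambda>n. \<bar>hyp_coeff a b c n * u ^ n\<bar>)"
  using summable_abs_hyp_coeff[OF c(1) excess]
proof (rule summable_comparison_test[rotated], intro exI allI impI)
  fix n show "norm \<bar>hyp_coeff a b c n * u ^ n\<bar> \<le> \<bar>hyp_coeff a b c n\<bar>"
    using assms power_le_one[of u n] by (simp add: abs_mult mult_left_le)
qed

lemma phi_1_pos: "phi 1 > 0"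
  using gauss_sum_pos[OF a b c(1) excess c_gt_a] by (simp add: phi_def gauss_sum_def)

text \<open>
  All coefficients except the constant one are non-positive.
\<close>
lemma phi_antimono:
  assumes "0 \<le> u" "u \<le> v" "v \<le> 1"
  shows "phi v \<le> phi u"
  unfolding phi_def
proof (intro suminf_le)
  fix n show "hyp_coeff a b c n * v ^ n \<le> hyp_coeff a b c n * u ^ n"
    using assms coeff_nonpos[of n] power_mono[of u v n] by (cases "n = 0") (auto intro: mult_left_mono_neg)
qed (rule summable_rabs_cancel[OF summable_phi], use assms in linarith, use assms in linarith)+

lemma continuous_phi: "continuous_on {0..1} phi"
proof -
  have "uniform_limit {0..1} (\<lambda>n x. \<Sum>i<n. hyp_coeff a b c i * x ^ i) phi sequentially"
    unfolding phi_def[abs_def]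
  proof (rule Weierstrass_m_test)
    fix n and u :: real assume "u \<in> {0..1}"
    then show "norm (hyp_coeff a b c n * u ^ n) \<le> \<bar>hyp_coeff a b c n\<bar>"
      using power_le_one[of u n] by (simp add: abs_mult mult_left_le)
  qed (rule summable_abs_hyp_coeff[OF c(1) excess])
  then show ?thesis
    by (rule uniform_limit_theorem[rotated]) (auto intro!: always_eventually continuous_intros)
qed

lemma phi_deriv:
  assumes "0 < u" "u < 1"
  obtains d where "(phi has_real_derivative d) (at u)" "d \<le> 0"
proof
  have "summable (\<lambda>n. hyp_coeff a b c n * 1 ^ n)"
    using summable_phi[of 1] by (auto intro: summable_rabs_cancel)
  from termdiffs_strong[OF this, of u]
  show "(phi has_real_derivative (\<Sum>n. diffs (hyp_coeff a b c) n * u ^ n)) (at u)"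
    using assms by (simp add: phi_def[abs_def])
  have "summable (\<lambda>n. diffs (hyp_coeff a b c) n * u ^ n)"
  proof (rule termdiff_converges[of u 1])
    fix x :: real assume "norm x < 1"
    then show "summable (\<lambda>n. hyp_coeff a b c n * x ^ n)"
      using summable_phi[of "\<bar>x\<bar>"] by (intro summable_norm_cancel[of "\<lambda>n. hyp_coeff a b c n * x ^ n"])
         (simp add: abs_mult power_abs)
  qed (use assms in auto)
  moreover have "diffs (hyp_coeff a b c) n * u ^ n \<le> 0" for n
    unfolding diffs_def using coeff_nonpos[of "Suc n"] assms
    by (intro mult_nonpos_nonneg mult_nonneg_nonpos) auto
  ultimately show "(\<Sum>n. diffs (hyp_coeff a b c) n * u ^ n) \<le> 0"
    using suminf_nonneg[of "\<lambda>n. - (diffs (hyp_coeff a b c) n * u ^ n)"]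
    by (simp add: suminf_minus summable_minus_iff)
qed

lemma h_pos: "0 < u \<Longrightarrow> u \<le> 1 \<Longrightarrow> h u > 0"
  unfolding h_def using phi_antimono[of u 1] phi_1_pos by (intro mult_pos_pos) auto

text \<open>
  Since \<open>c < 1\<close> the power factor decreases, and so does \<open>phi\<close>.  Positivity of \<open>phi 1\<close>, which
  is Gauss's series at $1$, turns this into a uniform strict bound.
\<close>
lemma h_deriv:
  assumes "0 < u" "u < 1"
  obtains d where "(h has_real_derivative d) (at u)" "d \<le> (c - 1) * phi 1"
proof -
  obtain d where d: "(phi has_real_derivative d) (at u)" "d \<le> 0" using phi_deriv[OF assms] .
  have "(h has_real_derivative ((c - 1) * u powr (c - 2) * phi u + d * u powr (c - 1))) (at u)"
    unfolding h_def[abs_def] using assms d(1) by (auto intro!: derivative_eq_intros)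
  moreover have "(c - 1) * u powr (c - 2) * phi u + d * u powr (c - 1) \<le> (c - 1) * phi 1"
  proof -
    have "u powr (c - 2) \<ge> u powr 0" using assms c by (intro powr_mono') auto
    then have "1 * phi 1 \<le> u powr (c - 2) * phi u"
      using phi_antimono[of u 1] phi_1_pos assms by (intro mult_mono) auto
    then have "(c - 1) * (u powr (c - 2) * phi u) \<le> (c - 1) * (1 * phi 1)"
      using c by (intro mult_left_mono_neg) auto
    moreover have "d * u powr (c - 1) \<le> 0" using d(2) by (intro mult_nonpos_nonneg) auto
    ultimately show ?thesis by (simp add: mult.assoc)
  qed
  ultimately show ?thesis by (rule that)
qed

text \<open>
  Integration term by term against the power series of \<open>phi\<close>.
\<close>
lemma h_moment:
  shows "integrable M (\<lambda>u. h u * (1 - u) ^ k)" and "integral\<^sup>L M (\<lambda>u. h u * (1 - u) ^ k) = moment k"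
proof -
  define f where "f n u = hyp_coeff a b c n * (u powr (c + real n - 1) * (1 - u) powr (real k + 1 - 1))" for n u
  have int: "integrable M (\<lambda>u. u powr (c + real n - 1) * (1 - u) powr (real k + 1 - 1))"
    and val: "integral\<^sup>L M (\<lambda>u. u powr (c + real n - 1) * (1 - u) powr (real k + 1 - 1)) = Beta (c + n) (real k + 1)" for n
    using Beta_integral_open_interval[of "c + n" "real k + 1"] c by auto
  have f_int: "integrable M (f n)" for n unfolding f_def by (intro integrable_mult_right int)
  have f_val: "integral\<^sup>L M (f n) = Beta c (real k + 1) * hyp_coeff a b (c + k + 1) n" for n
    unfolding f_def using val[of n] hyp_coeff_times_Beta[OF c(1), of a b n k] by simp
  have f_norm: "integral\<^sup>L M (\<lambda>u. norm (f n u)) = \<bar>Beta c (real k + 1) * hyp_coeff a b (c + k + 1) n\<bar>" for n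
  proof -
    have "integral\<^sup>L M (\<lambda>u. norm (f n u)) = integral\<^sup>L M (\<lambda>u. \<bar>hyp_coeff a b c n\<bar> * (u powr (c + real n - 1) * (1 - u) powr (real k + 1 - 1)))"
      by (intro Bochner_Integration.integral_cong refl) (simp add: f_def abs_mult)
    also have "\<dots> = \<bar>hyp_coeff a b c n\<bar> * Beta (c + n) (real k + 1)" using val[of n] by simp
    also have "\<dots> = \<bar>hyp_coeff a b c n * Beta (c + n) (real k + 1)\<bar>"
      using Beta_real_pos[of "c + n" "real k + 1"] c by (simp add: abs_mult)
    finally show ?thesis unfolding hyp_coeff_times_Beta[OF c(1)] .
  qed
  have pt: "(\<lambda>n. f n u) sums (h u * (1 - u) ^ k)" "summable (\<lambda>n. norm (f n u))" if u: "u \<in> {0<..<1}" for u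
  proof -
    have f_eq: "f n u = (hyp_coeff a b c n * u ^ n) * (u powr (c - 1) * (1 - u) ^ k)" for n
    proof -
      have "u powr (c + real n - 1) = u powr (c - 1) * u ^ n"
        using u by (simp add: powr_add[symmetric] powr_realpow[symmetric] algebra_simps)
      moreover have "(1 - u) powr (real k + 1 - 1) = (1 - u) ^ k" using u by (simp add: powr_realpow)
      ultimately show ?thesis by (simp add: f_def mult_ac)
    qed
    have S: "summable (\<lambda>n. \<bar>hyp_coeff a b c n * u ^ n\<bar>)" using summable_phi u by simp
    then have "(\<lambda>n. hyp_coeff a b c n * u ^ n) sums phi u"
      unfolding phi_def by (rule summable_sums[OF summable_rabs_cancel])
    from sums_mult2[OF this, of "u powr (c - 1) * (1 - u) ^ k"]
    show "(\<lambda>n. f n u) sums (h u * (1 - u) ^ k)" unfolding f_eq h_def by (simp add: mult_ac)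
    show "summable (\<lambda>n. norm (f n u))"
      unfolding f_eq using summable_mult2[OF S, of "\<bar>u powr (c - 1) * (1 - u) ^ k\<bar>"] by (simp add: abs_mult)
  qed
  have ae: "AE u in M. summable (\<lambda>n. norm (f n u))"
    by (rule AE_I2) (use pt(2) in simp)
  have sn: "summable (\<lambda>n. integral\<^sup>L M (\<lambda>u. norm (f n u)))"
    unfolding f_norm abs_mult by (intro summable_mult summable_abs_hyp_coeff shifted)
  have eq: "(\<Sum>n. f n u) = h u * (1 - u) ^ k" if "u \<in> space M" for u
    using pt(1)[of u] that by (simp add: sums_iff)
  have "integrable M (\<lambda>u. \<Sum>n. f n u)" by (rule integrable_suminf[OF f_int ae sn])
  then show "integrable M (\<lambda>u. h u * (1 - u) ^ k)"
    by (subst (asm) Bochner_Integration.integrable_cong[OF refl eq])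
  have "(\<lambda>n. integral\<^sup>L M (f n)) sums integral\<^sup>L M (\<lambda>u. \<Sum>n. f n u)"
    by (rule sums_integral[OF f_int ae sn])
  moreover have "integral\<^sup>L M (\<lambda>u. \<Sum>n. f n u) = integral\<^sup>L M (\<lambda>u. h u * (1 - u) ^ k)"
    by (intro Bochner_Integration.integral_cong refl eq)
  moreover have "(\<lambda>n. integral\<^sup>L M (f n)) sums moment k"
    unfolding f_val moment_def gauss_sum_def
    by (intro sums_mult summable_sums hyp_coeff_summable_and_limit(1) a b shifted)
  ultimately show "integral\<^sup>L M (\<lambda>u. h u * (1 - u) ^ k) = moment k"
    using sums_unique2 by metis
qed

lemma moment_pos: "moment k > 0"
  unfolding moment_def
  by (intro mult_pos_pos Beta_real_pos gauss_sum_pos a b shifted) (use c in auto)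

text \<open>
  The two-term recursion that identifies the moments, up to a constant factor, with the coefficients
  of the Lommel series: the contiguous relation combined with the recursion of the Beta function.
\<close>
lemma moment_Suc:
  "(c + k + 1 - a) * (c + k + 1 - b) * moment (Suc k) = (real k + 1) * (c + k + 1 - a - b) * moment k"
proof -
  have pos: "c + real k + 1 > 0" by (rule shifted)
  have "real k + 1 \<notin> \<int>\<^sub>\<le>\<^sub>0" by (auto elim!: nonpos_Ints_cases)
  from Beta_plus1_right[OF this, of c]
  have B: "(c + k + 1) * Beta c (real (Suc k) + 1) = (real k + 1) * Beta c (real k + 1)"
    by (simp add: algebra_simps)
  have G: "(c + k + 1 - a) * (c + k + 1 - b) * gauss_sum a b (c + Suc k + 1)
      = (c + k + 1) * (c + k + 1 - a - b) * gauss_sum a b (c + k + 1)"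
    using gauss_sum_contiguous[OF a b shifted(1,2), of k] by (simp add: add_ac)
  have "(c + k + 1 - a) * (c + k + 1 - b) * moment (Suc k)
      = Beta c (real (Suc k) + 1) * ((c + k + 1 - a) * (c + k + 1 - b) * gauss_sum a b (c + Suc k + 1))"
    by (simp add: moment_def mult_ac)
  also have "\<dots> = ((c + k + 1) * Beta c (real (Suc k) + 1)) * ((c + k + 1 - a - b) * gauss_sum a b (c + k + 1))"
    unfolding G by (simp only: mult_ac)
  also have "\<dots> = (real k + 1) * (c + k + 1 - a - b) * moment k"
    unfolding B moment_def by (simp only: mult_ac)
  finally show ?thesis .
qed

end

section \<open>Partial fractions of an entire function divided by the sine\<close>

lemma norm_sin_le_norm_times_exp:
  fixes w :: complex
  shows "norm (sin w) \<le> norm w * exp \<bar>Im w\<bar>"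
proof -
  have "norm (sin w - sin 0) \<le> exp \<bar>Im w\<bar> * norm (w - 0)"
  proof (rule field_differentiable_bound[of "closed_segment 0 w" sin cos])
    fix x assume "x \<in> closed_segment 0 w"
    then obtain u where u: "0 \<le> u" "u \<le> 1" "x = u *\<^sub>R w"
      by (auto simp: in_segment)
    then show "norm (cos x) \<le> exp \<bar>Im w\<bar>" using cmod_cos_le_exp[of u w] by simp
  qed (auto intro!: derivative_eq_intros)
  then show ?thesis by (simp add: mult.commute)
qed

text \<open>
  Circles through the points $(n+\frac12)\pi$ keep away from the zeros of the sine.  Far from the real
  axis $|\sin w|$ is comparable to $e^{|\mathrm{Im}\,w|}$ anyway; near the real axis the circle is almost
  vertical, so $\mathrm{Re}\,w$ stays within $\frac14$ of $\pm(n+\frac12)\pi$ and $\cos(2\,\mathrm{Re}\,w) \le 0$.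
\<close>
lemma exp_le_norm_sin_on_circle:
  fixes w :: complex and n :: nat
  assumes w: "norm w = (real n + 1/2) * pi" and n: "n > 0"
  shows "exp \<bar>Im w\<bar> \<le> 8 * norm (sin w)"
proof -
  define x y R e where "x = Re w" and "y = Im w" and "R = (real n + 1/2) * pi" and "e = exp \<bar>y\<bar>"
  have "exp (2 * y) + inverse (exp (2 * y)) = e\<^sup>2 + inverse (e\<^sup>2)"
    by (cases "y \<ge> 0") (auto simp: e_def exp_double exp_minus power_inverse)
  then have sin_sq: "norm (sin w) ^ 2 = (e\<^sup>2 + inverse (e\<^sup>2) - 2 * cos (2 * x)) / 4"
    unfolding norm_sin_squared x_def y_def by simp
  have "e\<^sup>2 \<le> 16 * (e\<^sup>2 + inverse (e\<^sup>2) - 2 * cos (2 * x))"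
  proof (cases "\<bar>y\<bar> \<ge> 1")
    case True
    have "2 \<le> e" using exp_ge_add_one_self[of "\<bar>y\<bar>"] True unfolding e_def by linarith
    then have "2\<^sup>2 \<le> e\<^sup>2" by (intro power_mono) auto
    then have "4 \<le> e\<^sup>2" by simp
    moreover have "inverse (e\<^sup>2) > 0" by (simp add: e_def)
    ultimately show ?thesis using cos_le_one[of "2 * x"] by argo
  next
    case False
    have "real n + 1/2 \<ge> 3/2" using n by simp
    then have "3/2 * 3 \<le> R" unfolding R_def using pi_gt3 by (intro mult_mono) auto
    then have R: "R > 4" by simp
    have "R\<^sup>2 = x\<^sup>2 + y\<^sup>2" using w cmod_power2[of w] by (simp add: R_def x_def y_def)
    then have prod: "(R - \<bar>x\<bar>) * (R + \<bar>x\<bar>) = y\<^sup>2" by (simp add: algebra_simps power2_eq_square)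
    have le: "\<bar>x\<bar> \<le> R" using abs_Re_le_cmod[of w] w by (simp add: R_def x_def)
    have "(R - \<bar>x\<bar>) * 4 \<le> (R - \<bar>x\<bar>) * (R + \<bar>x\<bar>)"
      using le R by (intro mult_left_mono) auto
    also have "\<dots> \<le> 1" using False prod by (simp add: abs_square_le_1)
    finally have d: "R - \<bar>x\<bar> \<le> 1/4" by simp
    have "cos (2 * x) = cos (2 * \<bar>x\<bar>)" by (metis abs_mult abs_numeral cos_abs_real)
    also have "2 * \<bar>x\<bar> = (2 * real n * pi - 2 * (R - \<bar>x\<bar>)) + pi" by (simp add: R_def algebra_simps)
    also have "cos \<dots> = - cos (2 * real n * pi - 2 * (R - \<bar>x\<bar>))" by simp
    also have "\<dots> = - cos (2 * (R - \<bar>x\<bar>))"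
    proof -
      have "sin (2 * real n * pi) = 0" "cos (2 * real n * pi) = 1"
        using sin_npi[of "2 * n"] cos_npi[of "2 * n"] by simp_all
      then show ?thesis by (simp only: cos_diff)
    qed
    finally have "cos (2 * x) = - cos (2 * (R - \<bar>x\<bar>))" .
    moreover have "cos (2 * (R - \<bar>x\<bar>)) \<ge> 0" using d le pi_gt3 by (intro cos_ge_zero) auto
    moreover have "inverse (e\<^sup>2) > 0" "e\<^sup>2 > 0" by (auto simp: e_def)
    ultimately show ?thesis by argo
  qed
  then have "e\<^sup>2 \<le> (8 * norm (sin w))\<^sup>2" using sin_sq by (simp add: power_mult_distrib)
  then show ?thesis unfolding e_def y_def by (rule power2_le_imp_le) simp
qed

text \<open>
  The numerator may vanish at the point as well, in which case the residue is $0$.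
\<close>
lemma residue_at_simple_zero_of_denominator:
  assumes "f holomorphic_on UNIV" "g holomorphic_on UNIV"
    and g: "g a = 0" "(g has_field_derivative g') (at a)" "g' \<noteq> 0"
  shows "residue (\<lambda>w. f w / g w) a = f a / g'"
proof -
  have quot: "(\<lambda>w. g w / (w - a)) \<midarrow>a\<rightarrow> g'"
    using g by (simp add: has_field_derivative_iff)
  then have "eventually (\<lambda>w. g w / (w - a) \<noteq> 0) (at a)"
    by (rule tendsto_imp_eventually_ne) (fact g)
  then have "eventually (\<lambda>w. g w \<noteq> 0) (at a)" by eventually_elim auto
  then obtain d where d: "d > 0" "\<And>w. w \<noteq> a \<Longrightarrow> dist w a < d \<Longrightarrow> g w \<noteq> 0"
    by (auto simp: eventually_at)
  show ?thesis
  proof (rule residue_simple'[where s = "ball a d"])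
    show "(\<lambda>w. f w / g w) holomorphic_on ball a d - {a}"
      using d(2) by (intro holomorphic_on_divide holomorphic_on_subset[OF assms(1)]
        holomorphic_on_subset[OF assms(2)]) (auto simp: dist_commute)
    have "f \<midarrow>a\<rightarrow> f a"
      using assms(1) by (simp add: holomorphic_on_open field_differentiable_imp_continuous_at
          field_differentiable_def isCont_def[symmetric] DERIV_isCont)
    then have "(\<lambda>w. f w / (g w / (w - a))) \<midarrow>a\<rightarrow> f a / g'"
      by (intro tendsto_divide quot g(3))
    then show "(\<lambda>w. f w / g w * (w - a)) \<midarrow>a\<rightarrow> f a / g'" by simp
  qed (use d in auto)
qed

lemma sum_symmetric_interval:
  fixes f :: "int \<Rightarrow> 'a :: comm_monoid_add"
  shows "(\<Sum>m\<in>{- int n..int n}. f m) = f 0 + (\<Sum>k<n. f (int (Suc k)) + f (- int (Suc k)))"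
proof (induction n)
  case (Suc n)
  have "{- int (Suc n)..int (Suc n)} = insert (int (Suc n)) (insert (- int (Suc n)) {- int n..int n})"
    by auto
  then show ?case by (simp add: Suc add_ac)
qed simp

text \<open>
  The Mittag-Leffler expansion of $E(w)/\sin w$ in symmetric form.  The residue theorem is applied to
  $E(w)/(\sin w\,(w^2-z^2))$ on the circles above: the growth bound on \<open>E\<close> makes the integrand
  $O(r^{-2})$ on the circle of radius \<open>r\<close>, so the integrals tend to $0$ and the residues sum to $0$.
\<close>
theorem partial_fractions_over_sine:
  fixes E :: "complex \<Rightarrow> complex"
  assumes holo: "E holomorphic_on UNIV"
    and even: "\<And>w. E (- w) = E w"
    and bound: "\<And>w. norm (E w) \<le> K * exp \<bar>Im w\<bar>"
    and z: "sin z \<noteq> 0"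
  shows "(\<lambda>k. 2 * (-1) ^ k * E (of_real (real (Suc k) * pi)) / (of_real ((real (Suc k) * pi)\<^sup>2) - z\<^sup>2))
           sums ((z * E z / sin z - E 0) / z\<^sup>2)"
proof -
  define p where "p m = (of_real (of_int m * pi) :: complex)" for m :: int
  define H where "H w = E w / (sin w * (w\<^sup>2 - z\<^sup>2))" for w
  define T where "T k = 2 * (-1) ^ k * E (of_real (real (Suc k) * pi)) / (of_real ((real (Suc k) * pi)\<^sup>2) - z\<^sup>2)" for k
  have z0: "z \<noteq> 0" using z by auto
  have sin_p: "sin (p m) = 0" for m unfolding p_def sin_eq_0 by blast
  have zp: "p m \<noteq> z" "p m \<noteq> - z" for m
    using sin_p[of m] z by auto
  have cos_p: "cos (p (int k)) = (-1) ^ k" "cos (p (- int k)) = (-1)^k" for k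
    using cos_npi[of k] unfolding p_def cos_of_real by auto
  have inj_p: "inj p" by (auto simp: inj_def p_def)
  have sq0: "w\<^sup>2 - z\<^sup>2 = 0 \<longleftrightarrow> w = z \<or> w = - z" for w by (simp add: power2_eq_iff)
  have dsin: "((\<lambda>w. sin w * (w\<^sup>2 - z\<^sup>2)) has_field_derivative (cos w * (w\<^sup>2 - z\<^sup>2) + sin w * (2 * w))) (at w)" for w
    by (auto intro!: derivative_eq_intros)
  have den_holo: "(\<lambda>w. sin w * (w\<^sup>2 - z\<^sup>2)) holomorphic_on UNIV"
    by (intro holomorphic_intros)
  have res: "residue H a = E a / (cos a * (a\<^sup>2 - z\<^sup>2) + sin a * (2 * a))"
    if "sin a * (a\<^sup>2 - z\<^sup>2) = 0" "cos a * (a\<^sup>2 - z\<^sup>2) + sin a * (2 * a) \<noteq> 0" for a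
    unfolding H_def by (rule residue_at_simple_zero_of_denominator[OF holo den_holo that(1) dsin that(2)])
  have res_p: "residue H (p m) = E (p m) / (cos (p m) * ((p m)\<^sup>2 - z\<^sup>2))" for m
  proof -
    have "cos (p m) \<noteq> 0" using sin_cos_squared_add[of "p m"] sin_p[of m] by auto
    then show ?thesis using zp[of m] sq0[of "p m"] by (subst res) (auto simp: sin_p)
  qed
  have res_z: "residue H z = E z / (sin z * (2 * z))"
    using z z0 by (subst res) auto
  have res_mz: "residue H (- z) = E z / (sin z * (2 * z))"
    using z z0 by (subst res) (auto simp: even)
  \<comment> \<open>the sum of the residues inside the \<open>n\<close>-th circle\<close>
  define G where "G n = E z / (sin z * z) - E 0 / z\<^sup>2 - (\<Sum>k<n. T k)" for n
  have integral: "contour_integral (circlepath 0 ((real n + 1/2) * pi)) H = 2 * pi * \<i> * G n"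
    if n: "norm z < (real n + 1/2) * pi" for n
  proof -
    define r where "r = (real n + 1/2) * pi"
    define P where "P = insert z (insert (-z) (p ` {- int n..int n}))"
    have rpos: "r > 0" by (simp add: r_def)
    have pnorm: "norm (p m) = \<bar>real_of_int m\<bar> * pi" for m by (simp add: p_def norm_mult)
    have psmall: "norm (p m) < r" if "m \<in> {- int n..int n}" for m
    proof -
      have "\<bar>real_of_int m\<bar> \<le> real n" using that by auto
      then show ?thesis unfolding pnorm r_def by (intro mult_strict_right_mono) auto
    qed
    \<comment> \<open>The slightly larger disc of radius \<open>r + pi / 4\<close> contains no further poles.\<close>
    have pbig: "norm (p m) \<ge> r + pi / 4" if "m \<notin> {- int n..int n}" for m
    proof -
      have "real n + 1 \<le> \<bar>real_of_int m\<bar>" using that by auto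
      then have "(real n + 1) * pi \<le> norm (p m)" unfolding pnorm by (intro mult_right_mono) auto
      then show ?thesis using pi_gt_zero unfolding r_def by (simp only: distrib_right)
    qed
    have Psmall: "norm a < r" if "a \<in> P" for a using that n psmall by (auto simp: P_def r_def)
    have "contour_integral (circlepath 0 r) H
        = 2 * pi * \<i> * (\<Sum>a\<in>P. winding_number (circlepath 0 r) a * residue H a)"
    proof (rule Residue_theorem)
      show "H holomorphic_on ball 0 (r + pi / 4) - P"
        unfolding H_def
      proof (intro holomorphic_on_divide holomorphic_on_subset[OF holo] holomorphic_on_subset[OF den_holo])
        fix w assume w: "w \<in> ball 0 (r + pi / 4) - P"
        have "sin w \<noteq> 0"
        proof
          assume "sin w = 0"
          then obtain m where "w = p m" unfolding sin_eq_0 p_def by auto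
          then show False
            using w pbig[of m] by (cases "m \<in> {- int n..int n}") (auto simp: P_def)
        qed
        then show "sin w * (w\<^sup>2 - z\<^sup>2) \<noteq> 0" using w sq0[of w] by (auto simp: P_def)
      qed auto
      show "path_image (circlepath 0 r) \<subseteq> ball 0 (r + pi / 4) - P"
        using Psmall rpos by (auto simp: path_image_circlepath sphere_def)
      have "w \<notin> cball 0 r" if "w \<notin> ball 0 (r + pi / 4)" for w :: complex
        using that pi_gt_zero unfolding mem_ball mem_cball by linarith
      then show "\<forall>w. w \<notin> ball 0 (r + pi / 4) \<longrightarrow> winding_number (circlepath 0 r) w = 0"
        using rpos
        by (intro allI impI winding_number_zero_outside[where s = "cball 0 r"])
           (auto simp: path_image_circlepath sphere_def)
    qed (auto simp: P_def)
    also have "(\<Sum>a\<in>P. winding_number (circlepath 0 r) a * residue H a) = (\<Sum>a\<in>P. residue H a)"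
      by (intro sum.cong refl) (use Psmall in \<open>simp add: winding_number_circlepath\<close>)
    also have "\<dots> = residue H z + residue H (- z) + (\<Sum>m\<in>{- int n..int n}. residue H (p m))"
    proof -
      have "z \<noteq> - z" using z0 by (simp add: eq_neg_iff_add_eq_0 flip: mult_2)
      then show ?thesis using zp unfolding P_def
        by (subst sum.insert, simp, force, subst sum.insert, simp, force,
            subst sum.reindex[OF inj_on_subset[OF inj_p]]) (auto simp: add_ac)
    qed
    also have "(\<Sum>m\<in>{- int n..int n}. residue H (p m)) = residue H (p 0) - (\<Sum>k<n. T k)"
    proof -
      have pm: "p (- m) = - p m" for m by (simp add: p_def)
      have "residue H (p (int (Suc k))) + residue H (p (- int (Suc k))) = - T k" for k
        unfolding res_p cos_p unfolding T_def pm even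
        by (cases "Parity.even k") (simp_all add: p_def minus_divide_right)
      then show ?thesis unfolding sum_symmetric_interval by (simp add: sum_negf)
    qed
    also have "residue H z + residue H (- z) + (residue H (p 0) - (\<Sum>k<n. T k)) = G n"
      unfolding res_z res_mz res_p G_def using z0 z by (simp add: p_def)
    finally show ?thesis by (simp add: r_def)
  qed
  have Knn: "K \<ge> 0" using order_trans[OF norm_ge_zero bound[of 0]] by simp
  define r where "r n = (real n + 1/2) * pi" for n
  have G_bound: "norm (G n) \<le> 8 * K * (r n / ((r n)\<^sup>2 - (norm z)\<^sup>2))" if n: "n > 0" "norm z < r n" for n
  proof -
    have rpos: "r n > 0" by (simp add: r_def)
    have sq: "(norm z)\<^sup>2 < (r n)\<^sup>2" using n(2) by (intro power_strict_mono) auto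
    have Hb: "norm (H w) \<le> 8 * K / ((r n)\<^sup>2 - (norm z)\<^sup>2)" and nz: "sin w * (w\<^sup>2 - z\<^sup>2) \<noteq> 0"
      if w: "norm w = r n" for w
    proof -
      have e: "exp \<bar>Im w\<bar> \<le> 8 * norm (sin w)"
        using exp_le_norm_sin_on_circle[of w n] w n by (simp add: r_def)
      then have spos: "norm (sin w) > 0" by (smt (verit) exp_gt_zero)
      have "norm (E w) \<le> K * (8 * norm (sin w))"
        using bound[of w] mult_left_mono[OF e Knn] by linarith
      moreover have dist: "(r n)\<^sup>2 - (norm z)\<^sup>2 \<le> norm (w\<^sup>2 - z\<^sup>2)"
        using norm_triangle_ineq2[of "w\<^sup>2" "z\<^sup>2"] by (simp add: norm_power w)
      ultimately have "norm (E w) / (norm (sin w) * norm (w\<^sup>2 - z\<^sup>2))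
          \<le> K * (8 * norm (sin w)) / (norm (sin w) * ((r n)\<^sup>2 - (norm z)\<^sup>2))"
        using sq spos Knn by (intro frac_le mult_left_mono) auto
      also have "\<dots> = 8 * K / ((r n)\<^sup>2 - (norm z)\<^sup>2)" using spos by simp
      finally show "norm (H w) \<le> 8 * K / ((r n)\<^sup>2 - (norm z)\<^sup>2)"
        by (simp add: H_def norm_mult norm_divide)
      have "w\<^sup>2 - z\<^sup>2 \<noteq> 0" using dist sq by force
      then show "sin w * (w\<^sup>2 - z\<^sup>2) \<noteq> 0" using spos by simp
    qed
    have "continuous_on (sphere 0 (r n)) H"
      unfolding H_def
      using nz holomorphic_on_imp_continuous_on[OF holomorphic_on_subset[OF holo, of "sphere 0 (r n)"]]
      by (intro continuous_on_divide continuous_intros) (auto simp: sphere_def)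
    then have "H contour_integrable_on circlepath 0 (r n)"
      using rpos by (intro contour_integrable_continuous_circlepath) (simp add: path_image_circlepath)
    then have "(H has_contour_integral (2 * pi * \<i> * G n)) (circlepath 0 (r n))"
      using integral n(2) has_contour_integral_integral unfolding r_def by fastforce
    then have "norm (2 * pi * \<i> * G n) \<le> 8 * K / ((r n)\<^sup>2 - (norm z)\<^sup>2) * (2 * pi * r n)"
      using Hb sq Knn rpos n(2) by (intro has_contour_integral_bound_circlepath divide_nonneg_nonneg) auto
    then have "(2 * pi) * norm (G n) \<le> (2 * pi) * (8 * K * (r n / ((r n)\<^sup>2 - (norm z)\<^sup>2)))"
      by (simp add: norm_mult mult_ac)
    then show ?thesis by (rule mult_left_le_imp_le) simp
  qed
  have "(\<lambda>n. 8 * K * (r n / ((r n)\<^sup>2 - (norm z)\<^sup>2))) \<longlonglongrightarrow> 0"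
    unfolding r_def by (intro tendsto_mult_right_zero) real_asymp
  moreover have "eventually (\<lambda>n. norm (G n) \<le> 8 * K * (r n / ((r n)\<^sup>2 - (norm z)\<^sup>2))) sequentially"
  proof -
    have "filterlim r at_top sequentially" unfolding r_def by real_asymp
    then have "eventually (\<lambda>n. norm z < r n) sequentially" by (simp add: filterlim_at_top_dense)
    then show ?thesis using eventually_gt_at_top[of 0] by eventually_elim (rule G_bound)
  qed
  ultimately have "G \<longlonglongrightarrow> 0" by (rule Lim_null_comparison[rotated])
  from tendsto_diff[OF tendsto_const[of "E z / (sin z * z) - E 0 / z\<^sup>2"] this]
  have "(\<lambda>n. \<Sum>k<n. T k) \<longlonglongrightarrow> E z / (sin z * z) - E 0 / z\<^sup>2"
    by (simp add: G_def)
  then show ?thesis unfolding sums_def T_def[symmetric] using z0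
    by (simp add: diff_divide_distrib power2_eq_square mult.commute)
qed

section \<open>The sine transform of the density\<close>

lemma sin_paired_complex:
  fixes z :: complex
  shows "(\<lambda>n. (-1) ^ n / fact (2 * n + 1) * z ^ (2 * n + 1)) sums sin z"
proof -
  have "(\<lambda>n. \<Sum>k = n * 2..<n * 2 + 2. of_real (sin_coeff k) * z ^ k) sums sin z"
    by (rule sums_group) (use sin_converges[of z, unfolded scaleR_conv_of_real] in auto)
  then show ?thesis by (simp add: sin_coeff_def ac_simps)
qed

lemma abs_cos_diff_le:
  fixes x y :: real
  shows "\<bar>cos x - cos y\<bar> \<le> \<bar>x - y\<bar>"
proof -
  have "\<bar>cos x - cos y\<bar> = 2 * \<bar>sin ((x + y) / 2)\<bar> * \<bar>sin ((y - x) / 2)\<bar>"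
    unfolding cos_diff_cos by (simp add: abs_mult)
  also have "\<dots> \<le> 2 * 1 * \<bar>(y - x) / 2\<bar>"
    by (intro mult_mono abs_sin_x_le_abs_x) auto
  finally show ?thesis by simp
qed

context gauss_density
begin

text \<open>
  With $t = \sqrt{1-u}$ this is $2\int_0^1 h(1-t^2) \sin(zt)\,dt$.
\<close>
definition transform :: "complex \<Rightarrow> complex" where
  "transform z = integral\<^sup>L M (\<lambda>u. of_real (h u) * (sin (z * of_real (sqrt (1 - u))) / of_real (sqrt (1 - u))))"

lemma moment_le_moment_0: "moment k \<le> moment 0"
proof -
  have "integral\<^sup>L M (\<lambda>u. h u * (1 - u) ^ k) \<le> integral\<^sup>L M (\<lambda>u. h u * (1 - u) ^ 0)"
  proof (rule integral_mono)
    fix u assume "u \<in> space M"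
    then have "h u > 0" "(1 - u) ^ k \<le> 1" using h_pos[of u] by (auto intro!: power_le_one)
    then show "h u * (1 - u) ^ k \<le> h u * (1 - u) ^ 0" by (simp add: mult_left_le)
  qed (rule h_moment)+
  then show ?thesis unfolding h_moment .
qed

lemma transform_sums: 
  "integrable M (\<lambda>u. of_real (h u) * (sin (z * of_real (sqrt (1 - u))) / of_real (sqrt (1 - u))))"
  "(\<lambda>k. (-1) ^ k * z ^ (2 * k + 1) / fact (2 * k + 1) * of_real (moment k)) sums transform z"
proof -
  define q where "q k = (-1) ^ k * z ^ (2 * k + 1) / fact (2 * k + 1)" for k
  define f where "f k u = q k * of_real (h u * (1 - u) ^ k)" for k u
  define F where "F u = of_real (h u) * (sin (z * of_real (sqrt (1 - u))) / of_real (sqrt (1 - u)))" for u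
  have q_summ: "summable (\<lambda>k. norm (q k))"
  proof -
    have "summable (\<lambda>k. norm z * (inverse (fact k) * (norm z ^ 2) ^ k))"
      by (intro summable_mult summable_exp)
    moreover have "norm (q k) \<le> norm z * (inverse (fact k) * (norm z ^ 2) ^ k)" for k
    proof -
      have "norm (q k) = norm z * (norm z ^ 2) ^ k / fact (2 * k + 1)"
        unfolding q_def norm_divide norm_mult norm_power norm_fact
        by (simp add: power_mult[symmetric])
      also have "\<dots> \<le> norm z * (norm z ^ 2) ^ k / fact k"
        by (intro divide_left_mono fact_mono mult_nonneg_nonneg) auto
      finally show ?thesis by (simp add: divide_inverse mult_ac)
    qed
    ultimately show ?thesis
      by (intro summable_comparison_test[OF _ \<open>summable (\<lambda>k. norm z * (inverse (fact k) * (norm z ^ 2) ^ k))\<close>]) auto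
  qed
  have f_int: "integrable M (f k)" for k
    unfolding f_def by (intro integrable_mult_right integrable_of_real h_moment)
  have f_val: "integral\<^sup>L M (f k) = q k * of_real (moment k)" for k
    unfolding f_def by (simp add: h_moment del: of_real_mult)
  have f_norm: "integral\<^sup>L M (\<lambda>u. norm (f k u)) = norm (q k) * moment k" for k
  proof -
    have "integral\<^sup>L M (\<lambda>u. norm (f k u)) = integral\<^sup>L M (\<lambda>u. norm (q k) * (h u * (1 - u) ^ k))"
    proof (intro Bochner_Integration.integral_cong refl)
      fix u assume "u \<in> space M"
      then have "h u * (1 - u) ^ k \<ge> 0" using h_pos[of u] by (auto intro!: mult_nonneg_nonneg)
      then show "norm (f k u) = norm (q k) * (h u * (1 - u) ^ k)"
        unfolding f_def norm_mult norm_of_real by simp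
    qed
    then show ?thesis by (simp add: h_moment)
  qed
  have pt: "(\<lambda>k. f k u) sums F u" "summable (\<lambda>k. norm (f k u))" if u: "u \<in> {0<..<1}" for u
  proof -
    define s where "s = sqrt (1 - u)"
    have s: "s > 0" "1 - u = s ^ 2" "0 \<le> s" "s \<le> 1" using u by (auto simp: s_def)
    have f_eq: "f k u = of_real (h u) * (((-1) ^ k / fact (2 * k + 1) * (z * of_real s) ^ (2 * k + 1)) / of_real s)" for k
      using s(1) unfolding f_def q_def s(2)
      by (simp add: power_mult_distrib power_mult[symmetric] mult_ac)
    show "(\<lambda>k. f k u) sums F u"
      unfolding f_eq F_def s_def[symmetric] by (intro sums_mult sums_divide sin_paired_complex)
    have "norm (f k u) \<le> h u * norm (q k)" for k
    proof -
      have "norm (f k u) = norm (q k) * h u * (1 - u) ^ k"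
      proof -
        have "h u * (1 - u) ^ k \<ge> 0" using h_pos[of u] u by (auto intro!: mult_nonneg_nonneg)
        then show ?thesis unfolding f_def norm_mult norm_of_real by simp
      qed
      also have "\<dots> \<le> norm (q k) * h u * 1"
        using u h_pos[of u] by (intro mult_left_mono power_le_one) auto
      finally show ?thesis by (simp add: mult.commute)
    qed
    then show "summable (\<lambda>k. norm (f k u))"
      by (intro summable_comparison_test[OF _ summable_mult[OF q_summ, of "h u"]]) auto
  qed
  have ae: "AE u in M. summable (\<lambda>n. norm (f n u))"
    by (rule AE_I2) (use pt(2) in simp)
  have sn: "summable (\<lambda>n. integral\<^sup>L M (\<lambda>u. norm (f n u)))"
  proof -
    have "norm (norm (q k) * moment k) \<le> moment 0 * norm (q k)" for k
      using moment_le_moment_0[of k] moment_pos[of k] by (simp add: abs_mult mult.commute mult_left_mono)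
    then show ?thesis unfolding f_norm
      by (intro summable_comparison_test[OF _ summable_mult[OF q_summ, of "moment 0"]]) auto
  qed
  have eq: "(\<Sum>n. f n u) = F u" if "u \<in> space M" for u
    using pt(1)[of u] that by (simp add: sums_iff)
  have "integrable M (\<lambda>u. \<Sum>n. f n u)" by (rule integrable_suminf[OF f_int ae sn])
  then show "integrable M (\<lambda>u. of_real (h u) * (sin (z * of_real (sqrt (1 - u))) / of_real (sqrt (1 - u))))"
    unfolding F_def[symmetric] by (subst (asm) Bochner_Integration.integrable_cong[OF refl eq])
  have "(\<lambda>n. integral\<^sup>L M (f n)) sums integral\<^sup>L M (\<lambda>u. \<Sum>n. f n u)"
    by (rule sums_integral[OF f_int ae sn])
  moreover have "integral\<^sup>L M (\<lambda>u. \<Sum>n. f n u) = transform z"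
    unfolding transform_def F_def[symmetric] by (intro Bochner_Integration.integral_cong refl eq)
  ultimately show "(\<lambda>k. (-1) ^ k * z ^ (2 * k + 1) / fact (2 * k + 1) * of_real (moment k)) sums transform z"
    unfolding f_val q_def by simp
qed

lemma norm_transform_le: "norm (transform z) \<le> moment 0 * (norm z * exp \<bar>Im z\<bar>)"
proof -
  have "norm (transform z) \<le> integral\<^sup>L M (\<lambda>u. (h u * (1 - u) ^ 0) * (norm z * exp \<bar>Im z\<bar>))"
    unfolding transform_def
  proof (rule Bochner_Integration.integral_norm_bound_integral[OF transform_sums(1)])
    show "integrable M (\<lambda>u. (h u * (1 - u) ^ 0) * (norm z * exp \<bar>Im z\<bar>))"
      by (intro integrable_mult_left h_moment)
    fix u assume "u \<in> space M"
    then have u: "0 < u" "u < 1" by auto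
    define s where "s = sqrt (1 - u)"
    have s: "0 < s" "s \<le> 1" using u by (auto simp: s_def)
    have "norm (sin (z * of_real s)) \<le> norm (z * of_real s) * exp \<bar>Im (z * of_real s)\<bar>"
      by (rule norm_sin_le_norm_times_exp)
    also have "\<dots> \<le> norm z * s * exp \<bar>Im z\<bar>"
    proof -
      have "\<bar>Im z\<bar> * s \<le> \<bar>Im z\<bar>" using s by (intro mult_left_le) auto
      then show ?thesis using s by (simp add: norm_mult abs_mult mult_left_mono)
    qed
    finally have "norm (sin (z * of_real s)) / s \<le> norm z * exp \<bar>Im z\<bar>"
      using s by (simp add: field_simps)
    then have "h u * (norm (sin (z * of_real s)) / s) \<le> h u * (norm z * exp \<bar>Im z\<bar>)"
      using h_pos[of u] u by (intro mult_left_mono) auto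
    then show "norm (of_real (h u) * (sin (z * of_real (sqrt (1 - u))) / of_real (sqrt (1 - u))))
        \<le> (h u * (1 - u) ^ 0) * (norm z * exp \<bar>Im z\<bar>)"
      using h_pos[of u] u s by (simp add: norm_mult norm_divide s_def[symmetric])
  qed
  also have "\<dots> = moment 0 * (norm z * exp \<bar>Im z\<bar>)" using h_moment(2)[of 0] by simp
  finally show ?thesis .
qed

definition real_transform :: "real \<Rightarrow> real" where
  "real_transform x = integral\<^sup>L M (\<lambda>u. h u * (sin (x * sqrt (1 - u)) / sqrt (1 - u)))"

lemma transform_of_real: "transform (of_real x) = of_real (real_transform x)"
  and real_transform_integrable: "integrable M (\<lambda>u. h u * (sin (x * sqrt (1 - u)) / sqrt (1 - u)))"
proof -
  have eq: "of_real (h u) * (sin (of_real x * of_real (sqrt (1 - u))) / of_real (sqrt (1 - u)))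
      = complex_of_real (h u * (sin (x * sqrt (1 - u)) / sqrt (1 - u)))" for u
    by (simp add: sin_of_real[symmetric])
  show "transform (of_real x) = of_real (real_transform x)"
    unfolding transform_def real_transform_def eq by (rule integral_complex_of_real)
  show "integrable M (\<lambda>u. h u * (sin (x * sqrt (1 - u)) / sqrt (1 - u)))"
    using transform_sums(1)[of "of_real x"] unfolding eq by (simp only: complex_of_real_integrable_eq)
qed

text \<open>
  Polya's observation: in the variable $t$ the density increases towards $1$, so at $z = k\pi$ the last
  half-wave of $\sin(k\pi t)$ dominates and determines the sign.  The proof integrates by parts against
  a primitive \<open>C\<close> of a multiple of the sine factor, normalized to vanish at $u = 0$.  Then $(-1)^k C \le 0$ and
  $h' < 0$, so the integral of $(-1)^k h' C$ is positive, and the boundary term at $u = 1$ has the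
  right sign.
\<close>
lemma real_transform_sign:
  assumes k: "k > 0"
  shows "(-1) ^ k * real_transform (real k * pi) < 0"
proof -
  define \<sigma> :: real where "\<sigma> = (-1) ^ k"
  define x where "x = real k * pi"
  have x: "x > 0" using k by (simp add: x_def)
  have \<sigma>: "\<sigma> * \<sigma> = 1" "cos x = \<sigma>" "\<bar>\<sigma>\<bar> = 1" "\<sigma> \<le> 1"
    using cos_npi[of k] by (auto simp: \<sigma>_def x_def power_mult_distrib[symmetric] uminus_power_if)
  define C where "C u = cos (x * sqrt (1 - u)) - \<sigma>" for u
  define C' where "C' u = x * (sin (x * sqrt (1 - u)) / sqrt (1 - u)) / 2" for u
  define G where "G u = h u * C u" for u
  \<comment> \<open>a derivative of \<open>h\<close> that satisfies the bound of \<open>h_deriv\<close>\<close>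
  define D where "D u = (SOME d. (h has_real_derivative d) (at u) \<and> d \<le> (c - 1) * phi 1)" for u
  have D: "(h has_real_derivative D u) (at u)" "D u \<le> (c - 1) * phi 1" if "u \<in> {0<..<1}" for u
  proof -
    have "\<exists>d. (h has_real_derivative d) (at u) \<and> d \<le> (c - 1) * phi 1" using h_deriv[of u] that by auto
    from someI_ex[OF this] show "(h has_real_derivative D u) (at u)" "D u \<le> (c - 1) * phi 1"
      unfolding D_def by auto
  qed
  have C_deriv: "(C has_real_derivative C' u) (at u)" if "u \<in> {0<..<1}" for u
    unfolding C_def[abs_def] C'_def using that
    by (auto intro!: derivative_eq_intros simp: field_simps)
  have contG: "continuous_on {0..1} G"
  proof -
    have "continuous (at u within {0..1}) G" if u: "u \<in> {0..1}" for u
    \<comment> \<open>At $0$ the density blows up like $u^{c-1}$, while \<open>C\<close> vanishes to first order.\<close>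
    proof (cases "u = 0")
      case True
      have b1: "\<bar>G v\<bar> \<le> x * phi 0 * v powr c" if v: "v \<in> {0..1}" for v
      proof -
        have "1 - v \<le> sqrt (1 - v)" using v by (intro real_le_rsqrt) (auto simp: power2_eq_square mult_left_le)
        moreover have "sqrt (1 - v) \<le> 1" using v by simp
        ultimately have "\<bar>sqrt (1 - v) - 1\<bar> \<le> v" by linarith
        then have "\<bar>x\<bar> * \<bar>sqrt (1 - v) - 1\<bar> \<le> x * v" using x by simp
        then have "\<bar>x * sqrt (1 - v) - x\<bar> \<le> x * v"
          unfolding abs_mult[symmetric] by (simp add: right_diff_distrib)
        then have C_le: "\<bar>C v\<bar> \<le> x * v"
          using abs_cos_diff_le[of "x * sqrt (1 - v)" x] \<sigma>(2) by (simp add: C_def)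
        have "0 < phi v" using phi_antimono[of v 1] phi_1_pos v by simp
        moreover have "phi v \<le> phi 0" using phi_antimono[of 0 v] v by simp
        ultimately have "\<bar>G v\<bar> \<le> v powr (c - 1) * phi 0 * (x * v)"
          unfolding G_def h_def abs_mult using C_le by (intro mult_mono) auto
        also have "v powr (c - 1) * phi 0 * (x * v) = x * phi 0 * (v powr (c - 1) * v)" by simp
        also have "v powr (c - 1) * v = v powr c" using v by (simp add: powr_mult_base mult.commute)
        finally show ?thesis .
      qed
      have "(G \<longlongrightarrow> 0) (at 0 within {0..1})"
      proof (rule Lim_null_comparison)
        show "eventually (\<lambda>v. norm (G v) \<le> x * phi 0 * v powr c) (at 0 within {0..1})"
          using b1 by (auto simp: eventually_at_filter)
        show "((\<lambda>v. x * phi 0 * v powr c) \<longlongrightarrow> 0) (at 0 within {0..1})"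
          using c by (intro tendsto_mult_right_zero tendsto_zero_powrI tendsto_intros)
            (auto simp: eventually_at_filter)
      qed
      moreover have "G 0 = 0" by (simp add: G_def h_def)
      ultimately show ?thesis using True by (simp add: continuous_within)
    next
      case False
      have "continuous_on {u/2..1} (\<lambda>v. v powr (c - 1) * phi v * (cos (x * sqrt (1 - v)) - \<sigma>))"
        using u False by (intro continuous_intros continuous_on_subset[OF continuous_phi]) auto
      then have "continuous_on {u/2..1} G" by (simp add: G_def[abs_def] h_def C_def)
      then have "continuous (at u within {u/2..1}) G"
        using u by (auto simp: continuous_on_eq_continuous_within)
      moreover have "at u within {u/2..1} = at u within {0..1}"
        using u False by (intro at_within_nhd[of _ "{u/2<..}"]) auto
      ultimately show ?thesis by (simp only: continuous_within)
    qed
    then show ?thesis by (simp add: continuous_on_eq_continuous_within)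
  qed
  have "((\<lambda>u. D u * C u + C' u * h u) has_integral (G 1 - G 0)) {0..1}"
  proof (rule fundamental_theorem_of_calculus_interior[OF _ contG])
    fix u :: real assume u: "u \<in> {0<..<1}"
    have "(G has_real_derivative (D u * C u + C' u * h u)) (at u)"
      unfolding G_def[abs_def] by (rule DERIV_mult[OF D(1)[OF u] C_deriv[OF u]])
    then show "(G has_vector_derivative (D u * C u + C' u * h u)) (at u)"
      by (simp add: has_real_derivative_iff_has_vector_derivative)
  qed simp
  moreover have "((\<lambda>u. C' u * h u) has_integral (x / 2 * real_transform x)) {0..1}"
  proof -
    have "((\<lambda>u. x / 2 * (h u * (sin (x * sqrt (1 - u)) / sqrt (1 - u)))) has_integral (x / 2 * real_transform x)) {0<..<1}"
      unfolding real_transform_def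
      by (intro has_integral_mult_right has_integral_integral_lebesgue_on real_transform_integrable) auto
    then show ?thesis by (simp add: has_integral_Icc_iff_Ioo C'_def mult_ac)
  qed
  ultimately have "((\<lambda>u. (D u * C u + C' u * h u) - C' u * h u) has_integral (G 1 - G 0 - x / 2 * real_transform x)) {0..1}"
    by (rule has_integral_diff)
  then have DC: "((\<lambda>u. \<sigma> * (D u * C u)) has_integral (\<sigma> * (G 1 - G 0 - x / 2 * real_transform x))) {0<..<1}"
    by (simp add: has_integral_Icc_iff_Ioo has_integral_mult_right)
  define \<epsilon> where "\<epsilon> = (1 - c) * phi 1"
  have \<epsilon>: "\<epsilon> > 0" using c phi_1_pos by (simp add: \<epsilon>_def)
  define J where "J u = 1 - \<sigma> * cos (x * sqrt (1 - u))" for u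
  have J_nonneg: "J u \<ge> 0" for u
  proof -
    have "\<bar>\<sigma> * cos (x * sqrt (1 - u))\<bar> \<le> 1"
      unfolding abs_mult \<sigma>(3) using abs_cos_le_one[of "x * sqrt (1 - u)"] by simp
    then show ?thesis unfolding J_def by linarith
  qed
  have J_C: "\<sigma> * C u = - J u" for u using \<sigma>(1) by (simp add: C_def J_def algebra_simps)
  have contJ: "continuous_on {0..1} J" unfolding J_def[abs_def] by (intro continuous_intros)
  have J_int: "integral {0..1} J > 0"
  proof -
    \<comment> \<open>a point where \<open>J\<close> equals $2$: the cosine is shifted by half a period from its value \<open>\<sigma>\<close>\<close>
    define t where "t = 1 - 1 / real k"
    have t: "0 \<le> t" "t \<le> 1" using k by (auto simp: t_def field_simps)
    have xt: "x * t = x - pi" using k by (simp add: x_def t_def right_diff_distrib)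
    have "J (1 - t\<^sup>2) = 2" using t \<sigma>(1,2) by (simp add: J_def xt)
    moreover have "1 - t\<^sup>2 \<in> {0..1}" using t by (auto simp: power_le_one)
    ultimately have "integral {0..1} J \<noteq> 0"
      using integral_eq_0_iff[OF contJ] J_nonneg by fastforce
    moreover have "integral {0..1} J \<ge> 0"
      by (intro integral_nonneg integrable_continuous_real contJ J_nonneg)
    ultimately show ?thesis by simp
  qed
  have "((\<lambda>u. \<epsilon> * J u) has_integral (\<epsilon> * integral {0..1} J)) {0<..<1}"
    using integrable_integral[OF integrable_continuous_real[OF contJ]]
    by (simp add: has_integral_Icc_iff_Ioo has_integral_mult_right)
  then have "\<epsilon> * integral {0..1} J \<le> \<sigma> * (G 1 - G 0 - x / 2 * real_transform x)"
  proof (rule has_integral_le[OF _ DC])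
    fix u :: real assume u: "u \<in> {0<..<1}"
    have "\<epsilon> * J u \<le> - D u * J u"
      using D(2)[OF u] J_nonneg[of u] by (intro mult_right_mono) (auto simp: \<epsilon>_def algebra_simps)
    also have "\<dots> = D u * (\<sigma> * C u)" unfolding J_C by simp
    finally show "\<epsilon> * J u \<le> \<sigma> * (D u * C u)" by (simp add: mult_ac)
  qed
  moreover have "\<sigma> * G 1 \<le> 0"
  proof -
    have "\<sigma> * G 1 = phi 1 * (\<sigma> - 1)" using \<sigma>(1) by (simp add: G_def h_def C_def algebra_simps)
    then show ?thesis using phi_1_pos \<sigma>(4) by (simp add: mult_nonneg_nonpos)
  qed
  moreover have "G 0 = 0" by (simp add: G_def h_def)
  ultimately have "x / 2 * (\<sigma> * real_transform x) < 0"
    using mult_pos_pos[OF \<epsilon> J_int] by (simp add: algebra_simps)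
  then show ?thesis using x by (simp add: \<sigma>_def x_def mult_less_0_iff)
qed

end

section \<open>Zeros of functions with alternating signs at the multiples of pi\<close>

text \<open>
  The hypotheses under which the zeros are located: \<open>E\<close> is an even entire function of exponential type
  $1$, bounded and real on the real line, positive at $0$, without zeros on the imaginary axis, and with
  signs at $\pi, 2\pi, 3\pi, \dots$ that alternate starting with a positive one.  The function \<open>e\<close> is
  the restriction of \<open>E\<close> to the reals.
\<close>
locale alternating_at_multiples_of_pi =
  fixes E :: "complex \<Rightarrow> complex" and e :: "real \<Rightarrow> real" and K :: real
  assumes holo: "E holomorphic_on UNIV"
    and even: "\<And>w. E (- w) = E w"
    and bound: "\<And>w. norm (E w) \<le> K * exp \<bar>Im w\<bar>"
    and real: "\<And>x. E (of_real x) = of_real (e x)"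
    and pos_0: "e 0 > 0"
    and alternating: "\<And>k. (-1) ^ k * e (real (Suc k) * pi) > 0"
    and nonzero_imaginary: "\<And>y. E (\<i> * of_real y) \<noteq> 0"
begin

text \<open>
  Both are indexed so that \<open>k\<close> belongs to the point $(k+1)\pi$; poles are taken in the variable
  $z^2$.
\<close>
definition pole :: "nat \<Rightarrow> real" where "pole k = (real (Suc k) * pi)\<^sup>2"
definition weight :: "nat \<Rightarrow> real" where "weight k = 2 * ((-1) ^ k * e (real (Suc k) * pi))"

lemma pole_pos: "pole k > 0" by (simp add: pole_def)
lemma weight_pos: "weight k > 0" using alternating[of k] by (simp add: weight_def)

text \<open>
  The alternating signs of $E(k\pi)$ cancel against those of $\cos(k\pi)$, so all weights are positive.
  Thus $zE(z)/\sin z$ is, in the variable $z^2$, a Nevanlinna function.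
\<close>
lemma expansion:
  assumes z: "sin z \<noteq> 0"
  shows "(\<lambda>k. of_real (weight k) * (z\<^sup>2 / (of_real (pole k) - z\<^sup>2))) sums (z * E z / sin z - of_real (e 0))"
proof -
  have z0: "z \<noteq> 0" using z by auto
  have E0: "E 0 = of_real (e 0)" using real[of 0] by simp
  have "2 * (-1) ^ k * E (of_real (real (Suc k) * pi)) = of_real (weight k)" for k
    unfolding real weight_def by simp
  then have "(\<lambda>k. of_real (weight k) / (of_real (pole k) - z\<^sup>2)) sums ((z * E z / sin z - of_real (e 0)) / z\<^sup>2)"
    using partial_fractions_over_sine[OF holo even bound z] by (simp add: pole_def E0)
  from sums_mult[OF this, of "z\<^sup>2"] show ?thesis using z0 by (simp add: mult_ac)
qed

lemma expansion_real:
  assumes x: "sin x \<noteq> 0"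
  shows "(\<lambda>k. weight k * (x\<^sup>2 / (pole k - x\<^sup>2))) sums (x * e x / sin x - e 0)"
proof -
  have "sin (of_real x :: complex) \<noteq> 0" using x by (simp add: sin_of_real)
  from expansion[OF this]
  have "(\<lambda>k. of_real (weight k * (x\<^sup>2 / (pole k - x\<^sup>2))) :: complex) sums of_real (x * e x / sin x - e 0)"
    by (simp add: real sin_of_real)
  then show ?thesis by (subst (asm) sums_of_real_iff)
qed

lemma nonzero_at_multiple_of_pi: "e (real (Suc k) * pi) \<noteq> 0"
  using alternating[of k] by auto

text \<open>
  If $z^2$ is not real, then the imaginary parts of all terms of the expansion have the sign of
  $\mathrm{Im}\,z^2$, so they cannot sum to the imaginary part $0$ of $-E(0)$.  Hence $z^2$ is real at
  a zero, and the imaginary axis is excluded by hypothesis.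
\<close>
lemma zero_real:
  assumes "E z = 0"
  shows "z \<in> \<real>"
proof (cases "sin z = 0")
  case True
  then show ?thesis by (auto simp: sin_eq_0)
next
  case False
  define w where "w = z\<^sup>2"
  have "(\<lambda>k. Im (of_real (weight k) * (w / (of_real (pole k) - w)))) sums Im (z * E z / sin z - of_real (e 0))"
    unfolding w_def by (rule sums_Im[OF expansion[OF False]])
  moreover have "Im (of_real (weight k) * (w / (of_real (pole k) - w)))
      = Im w * (weight k * pole k / (norm (of_real (pole k) - w))\<^sup>2)" for k
  proof -
    have "Im (w / (of_real (pole k) - w)) = Im w * pole k / (norm (of_real (pole k) - w))\<^sup>2"
      by (simp add: Im_divide cmod_power2 algebra_simps)
    moreover have "Im (of_real (weight k) * u) = weight k * Im u" for u by simp
    ultimately have "Im (of_real (weight k) * (w / (of_real (pole k) - w)))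
        = weight k * (Im w * pole k / (norm (of_real (pole k) - w))\<^sup>2)" by presburger
    then show ?thesis by (simp only: times_divide_eq_right mult.commute mult.left_commute)
  qed
  ultimately have S: "(\<lambda>k. Im w * (weight k * pole k / (norm (of_real (pole k) - w))\<^sup>2)) sums 0"
    using assms by simp
  have "Im w = 0"
  proof (rule ccontr)
    assume w: "Im w \<noteq> 0"
    have "(\<lambda>k. weight k * pole k / (norm (of_real (pole k) - w))\<^sup>2) sums 0"
      using sums_mult_D[OF S w] by simp
    moreover have "weight k * pole k / (norm (of_real (pole k) - w))\<^sup>2 > 0" for k
    proof -
      have "of_real (pole k) - w \<noteq> 0" using w by (auto simp: complex_eq_iff)
      then show ?thesis using weight_pos pole_pos by simp
    qed
    ultimately show False
      using suminf_pos[of "\<lambda>k. weight k * pole k / (norm (of_real (pole k) - w))\<^sup>2"] by (simp add: sums_iff)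
  qed
  then have "Re z = 0 \<or> Im z = 0" by (auto simp: w_def power2_eq_square)
  then show ?thesis
  proof
    assume "Re z = 0"
    then have "z = \<i> * of_real (Im z)" by (simp add: complex_eq_iff)
    then show ?thesis using nonzero_imaginary[of "Im z"] assms by metis
  next
    assume "Im z = 0" then show ?thesis by (simp add: complex_is_Real_iff)
  qed
qed

lemma sin_nonzero_between:
  assumes "x \<in> {real m * pi<..<(real m + 1) * pi}"
  shows "sin x \<noteq> 0"
proof
  assume "sin x = 0"
  then obtain j :: int where j: "x = of_int j * pi" by (auto simp: sin_zero_iff_int2)
  then have "real m < of_int j" "of_int j < real m + 1" using assms by auto
  then have "int m < j" "j < int m + 1" by linarith+
  then show False by simp
qed

text \<open>
  Before the first pole all terms of the expansion are positive.
\<close>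
lemma pos_first_interval:
  assumes x: "x \<in> {0<..<pi}"
  shows "e x > 0"
proof -
  have s: "sin x > 0" using x by (intro sin_gt_zero) auto
  have "weight k * (x\<^sup>2 / (pole k - x\<^sup>2)) > 0" for k
  proof -
    have "pi \<le> real (Suc k) * pi" by (simp add: mult_le_cancel_right1)
    then have "x < real (Suc k) * pi" using x unfolding greaterThanLessThan_iff by linarith
    then have "x\<^sup>2 < pole k" unfolding pole_def using x by (intro power_strict_mono) auto
    then show ?thesis using x weight_pos[of k] by simp
  qed
  then have "x * e x / sin x - e 0 > 0"
    using expansion_real[of x] s suminf_pos[of "\<lambda>k. weight k * (x\<^sup>2 / (pole k - x\<^sup>2))"]
    by (simp add: sums_iff)
  then have "x * e x / sin x > 0" using pos_0 by simp
  then show ?thesis using s x by (simp add: zero_less_divide_iff zero_less_mult_iff)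
qed

text \<open>
  Every term of the expansion increases between consecutive poles.  The quantitative form, a lower bound
  by the increment of the first term, also yields simplicity of the zeros.
\<close>
lemma increase_between_poles:
  assumes x: "x \<in> {real m * pi<..<(real m + 1) * pi}" and y: "y \<in> {real m * pi<..<(real m + 1) * pi}"
    and xy: "x < y"
  shows "y * e y / sin y - x * e x / sin x
    \<ge> weight 0 * (pole 0 * (y\<^sup>2 - x\<^sup>2) / ((pole 0 - y\<^sup>2) * (pole 0 - x\<^sup>2)))"
    and "weight 0 * (pole 0 * (y\<^sup>2 - x\<^sup>2) / ((pole 0 - y\<^sup>2) * (pole 0 - x\<^sup>2))) > 0"
proof -
  define t where "t k = weight k * (pole k * (y\<^sup>2 - x\<^sup>2) / ((pole k - y\<^sup>2) * (pole k - x\<^sup>2)))" for k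
  have x0: "x > 0" using x by (auto intro: le_less_trans[of 0 "real m * pi" x])
  have sq: "x\<^sup>2 < y\<^sup>2" using x0 xy by (intro power_strict_mono) auto
  have same: "(pole k - y\<^sup>2) * (pole k - x\<^sup>2) > 0" for k
  proof (cases "k < m")
    case True
    then have "real (Suc k) * pi \<le> real m * pi" by (intro mult_right_mono) auto
    then have "real (Suc k) * pi < x" using x unfolding greaterThanLessThan_iff by linarith
    then have "pole k < x\<^sup>2" unfolding pole_def by (intro power_strict_mono) auto
    with sq show ?thesis by (intro mult_neg_neg) auto
  next
    case False
    then have "(real m + 1) * pi \<le> real (Suc k) * pi" by (intro mult_right_mono) auto
    then have "y < real (Suc k) * pi" using y unfolding greaterThanLessThan_iff by linarith
    then have "y\<^sup>2 < pole k" unfolding pole_def using xy x0 by (intro power_strict_mono) auto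
    with sq show ?thesis by (intro mult_pos_pos) auto
  qed
  have tpos: "t k > 0" for k
    unfolding t_def using same[of k] weight_pos[of k] pole_pos[of k] sq by simp
  have "weight k * (y\<^sup>2 / (pole k - y\<^sup>2)) - weight k * (x\<^sup>2 / (pole k - x\<^sup>2)) = t k" for k
  proof -
    have nz: "pole k - y\<^sup>2 \<noteq> 0" "pole k - x\<^sup>2 \<noteq> 0" using same[of k] by auto
    have "y\<^sup>2 / (pole k - y\<^sup>2) - x\<^sup>2 / (pole k - x\<^sup>2) = pole k * (y\<^sup>2 - x\<^sup>2) / ((pole k - y\<^sup>2) * (pole k - x\<^sup>2))"
      unfolding diff_frac_eq[OF nz] by (simp add: algebra_simps)
    then show ?thesis unfolding t_def by (simp only: right_diff_distrib[symmetric])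
  qed
  then have S: "t sums (y * e y / sin y - x * e x / sin x)"
    using sums_diff[OF expansion_real[OF sin_nonzero_between[OF y]] expansion_real[OF sin_nonzero_between[OF x]]]
    by simp
  have "(\<Sum>k<1. t k) \<le> suminf t"
    using S tpos by (intro sum_le_suminf) (auto simp: sums_iff intro: less_imp_le)
  then show "y * e y / sin y - x * e x / sin x
    \<ge> weight 0 * (pole 0 * (y\<^sup>2 - x\<^sup>2) / ((pole 0 - y\<^sup>2) * (pole 0 - x\<^sup>2)))"
    using S by (simp add: sums_iff t_def)
  show "weight 0 * (pole 0 * (y\<^sup>2 - x\<^sup>2) / ((pole 0 - y\<^sup>2) * (pole 0 - x\<^sup>2))) > 0"
    using tpos[of 0] by (simp add: t_def)
qed

lemma at_most_one_zero_between:
  assumes "x \<in> {real m * pi<..<(real m + 1) * pi}" "y \<in> {real m * pi<..<(real m + 1) * pi}"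
    and "e x = 0" "e y = 0"
  shows "x = y"
proof -
  have False if "x < y" "x \<in> {real m * pi<..<(real m + 1) * pi}" "y \<in> {real m * pi<..<(real m + 1) * pi}"
    "e x = 0" "e y = 0" for x y
    using increase_between_poles[OF that(2,3,1)] that(4,5) by simp
  then show ?thesis using assms by (metis linorder_neqE_linordered_idom)
qed

lemma zero_between_multiples_of_pi:
  assumes x: "x > 0" "e x = 0"
  obtains k :: nat where "k \<ge> 1" "x \<in> {real k * pi<..<(real k + 1) * pi}"
proof -
  define k where "k = nat \<lfloor>x / pi\<rfloor>"
  have fl: "real k = of_int \<lfloor>x / pi\<rfloor>" using x by (simp add: k_def)
  have "real k \<le> x / pi" "x / pi < real k + 1" unfolding fl by linarith+
  then have le: "real k * pi \<le> x" "x < (real k + 1) * pi"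
    by (simp_all add: field_simps)
  have k1: "k \<ge> 1"
  proof (rule ccontr)
    assume "\<not> k \<ge> 1"
    then have "k = 0" by simp
    then have "x \<in> {0<..<pi}" using x le by simp
    from pos_first_interval[OF this] x show False by simp
  qed
  have "real k * pi \<noteq> x" using nonzero_at_multiple_of_pi[of "k - 1"] k1 x by auto
  then show ?thesis using that[OF k1] le by auto
qed

lemma continuous_e: "continuous_on A e"
proof -
  have "e = (\<lambda>x. Re (E (of_real x)))" by (simp add: real)
  moreover have "continuous_on A (\<lambda>x. Re (E (of_real x)))"
    by (intro continuous_intros continuous_on_compose2[OF holomorphic_on_imp_continuous_on[OF holo]]) auto
  ultimately show ?thesis by simp
qed

lemma ex_zero_between:
  assumes "k \<ge> 1"
  shows "\<exists>x. x \<in> {real k * pi<..<(real k + 1) * pi} \<and> e x = 0"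
proof -
  obtain j where j: "k = Suc j" using assms by (cases k) auto
  let ?a = "real k * pi" and ?b = "(real k + 1) * pi"
  have ab: "?a \<le> ?b" by (simp add: distrib_right)
  have sa: "(-1) ^ j * e ?a > 0" and sb: "(-1) ^ j * e ?b < 0"
    using alternating[of j] alternating[of k] by (auto simp: j add_ac)
  have "\<exists>x. ?a \<le> x \<and> x \<le> ?b \<and> - ((-1) ^ j * e x) = 0"
    using sa sb ab by (intro IVT' continuous_intros continuous_e) auto
  then obtain x where x: "?a \<le> x" "x \<le> ?b" "e x = 0" by auto
  moreover have "x \<noteq> ?a" "x \<noteq> ?b" using x sa sb by auto
  ultimately show ?thesis by (intro exI[of _ x]) auto
qed

text \<open>
  At a double zero the difference quotient of \<open>e\<close> would tend to $0$, whereas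
  \<open>increase_between_poles\<close> keeps the quotient of $x\,e(x)/\sin x$ above a positive limit.
\<close>
lemma zero_simple:
  assumes x: "x > 0" "e x = 0"
  shows "deriv E (of_real x) \<noteq> 0"
proof
  assume d: "deriv E (of_real x) = 0"
  obtain m where m: "m \<ge> 1" "x \<in> {real m * pi<..<(real m + 1) * pi}"
    using zero_between_multiples_of_pi[OF x] by blast
  let ?c = "\<lambda>y. weight 0 * (pole 0 * (y + x) / ((pole 0 - y\<^sup>2) * (pole 0 - x\<^sup>2)))"
  have "(E has_field_derivative 0) (at (of_real x))"
    using holo d by (metis DERIV_deriv_iff_field_differentiable UNIV_I holomorphic_on_imp_differentiable_at open_UNIV)
  then have "((\<lambda>y. E (of_real y)) has_vector_derivative 0) (at x)"
    by (rule has_vector_derivative_real_field)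
  then have "((\<lambda>y. Re (E (of_real y))) has_real_derivative Re 0) (at x)"
    by (rule has_field_derivative_Re)
  then have "((\<lambda>y. e y / (y - x)) \<longlongrightarrow> 0) (at x)"
    by (simp add: real has_field_derivative_iff x(2))
  then have "((\<lambda>y. e y / (y - x)) \<longlongrightarrow> 0) (at_right x)"
    by (rule tendsto_within_subset) simp
  then have lim: "((\<lambda>y. (e y / (y - x)) * (y / sin y)) \<longlongrightarrow> 0 * (x / sin x)) (at_right x)"
    using sin_nonzero_between[OF m(2)] by (intro tendsto_intros) auto
  have p0: "pole 0 < x\<^sup>2"
  proof -
    have "1 * pi \<le> real m * pi" using m(1) by (intro mult_right_mono) auto
    then have "pi < x" using m(2) unfolding greaterThanLessThan_iff by linarith
    then show ?thesis unfolding pole_def by (intro power_strict_mono) auto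
  qed
  have clim: "(?c \<longlongrightarrow> ?c x) (at_right x)"
    using p0 by (intro tendsto_intros) auto
  have "eventually (\<lambda>y. y \<in> {x<..<(real m + 1) * pi}) (at_right x)"
    using m(2) by (intro eventually_at_right_real) auto
  then have "eventually (\<lambda>y. ?c y \<le> (e y / (y - x)) * (y / sin y)) (at_right x)"
  proof eventually_elim
    case (elim y)
    then have y: "y \<in> {real m * pi<..<(real m + 1) * pi}" and xy: "x < y" using m(2) by auto
    have "?c y * (y - x) \<le> y * e y / sin y"
      using increase_between_poles(1)[OF m(2) y xy] x(2) by (simp add: power2_eq_square algebra_simps)
    then have "?c y \<le> y * e y / sin y / (y - x)" using xy by (subst pos_le_divide_eq) auto
    also have "\<dots> = (e y / (y - x)) * (y / sin y)" by (simp add: mult.commute)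
    finally show ?case .
  qed
  then have "?c x \<le> 0 * (x / sin x)"
    by (intro tendsto_le[OF _ lim clim]) auto
  moreover have "?c x > 0"
    using p0 x weight_pos[of 0] pole_pos[of 0] by (intro mult_pos_pos divide_pos_pos mult_neg_neg) auto
  ultimately show False by simp
qed

lemma zero_simple_complex:
  assumes z: "z \<noteq> 0" "E z = 0"
  shows "deriv E z \<noteq> 0"
proof -
  obtain x where x: "z = of_real x" using zero_real[OF z(2)] by (auto elim: Reals_cases)
  then have "x \<noteq> 0" "e x = 0" using z real[of x] by auto
  moreover have "e (- x) = e x" using even[of "of_real x"] real[of x] real[of "- x"] by simp
  moreover have "deriv E z = - deriv E (- z)"
  proof -
    have "(E has_field_derivative deriv E (- z)) (at (- z))"
      using holo by (simp add: holomorphic_derivI)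
    then have "((\<lambda>w. E (- w)) has_field_derivative (deriv E (- z) * (-1))) (at z)"
      by (intro DERIV_chain2[where f = E]) (auto intro!: derivative_eq_intros)
    then show ?thesis by (simp add: even DERIV_imp_deriv)
  qed
  ultimately show ?thesis
    using zero_simple[of x] zero_simple[of "- x"] x by (cases "x > 0") auto
qed

end

section \<open>The Lommel function\<close>

definition lommel_denominator :: "real \<Rightarrow> real \<Rightarrow> nat \<Rightarrow> real" where
  "lommel_denominator \<mu> \<nu> k = (\<Prod>j=0..k. (\<mu> + 2 * real j + 1)\<^sup>2 - \<nu>\<^sup>2)"

text \<open>
  The even entire factor $z^{-\mu-1}s_{\mu,\nu}(z)$ of the Lommel function.
\<close>
definition lommel_entire :: "real \<Rightarrow> real \<Rightarrow> complex \<Rightarrow> complex" where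
  "lommel_entire \<mu> \<nu> z = (\<Sum>k. (-1) ^ k * z ^ (2 * k) / of_real (lommel_denominator \<mu> \<nu> k))"

locale lommel_parameters =
  fixes \<mu> \<nu> :: real
  assumes mu: "-1/2 < \<mu>" "\<mu> < 1/2" and nu: "\<bar>\<mu>\<bar> < \<nu>" "\<nu> < \<mu> + 1"
begin

text \<open>
  With these parameters the factors \<open>(c + k + 1 - a) * (c + k + 1 - b)\<close> in \<open>moment_Suc\<close> are a
  quarter of the factors $(\mu+2k+3)^2-\nu^2$ of the Lommel denominators, and the excess is
  $\frac12$.  The hypothesis $|\mu| < \frac12$ gives \<open>0 < c\<close> and \<open>c < 1\<close>, $|\mu| < \nu$ gives \<open>a > 0\<close> and
  \<open>b < 0\<close>, and $\nu < \mu+1$ gives \<open>b > -1\<close> and \<open>c > a\<close>.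
\<close>
sublocale gauss_density "(\<mu> + \<nu>) / 2" "(\<mu> - \<nu>) / 2" "\<mu> + 1/2"
  by unfold_locales (use mu nu in \<open>auto simp: field_simps\<close>)

abbreviation den :: "nat \<Rightarrow> real" where "den \<equiv> lommel_denominator \<mu> \<nu>"

lemma factor_pos: "(\<mu> + 2 * real j + 1)\<^sup>2 - \<nu>\<^sup>2 > 0"
proof -
  have "0 \<le> \<nu>" "\<nu> < \<mu> + 2 * real j + 1" using nu by auto
  then show ?thesis using power_strict_mono[of \<nu> "\<mu> + 2 * real j + 1" 2] by simp
qed

lemma den_pos: "den k > 0"
  unfolding lommel_denominator_def by (intro prod_pos) (use factor_pos in auto)

definition \<kappa> :: real where "\<kappa> = 1 / (moment 0 * den 0)"

lemma \<kappa>_pos: "\<kappa> > 0" using den_pos[of 0] moment_pos[of 0] by (simp add: \<kappa>_def)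

lemma reciprocal_den: "1 / den k = \<kappa> * moment k / fact (2 * k + 1)"
proof (induction k)
  case 0
  then show ?case using moment_pos[of 0] by (simp add: \<kappa>_def)
next
  case (Suc k)
  let ?q = "(\<mu> + 2 * real (Suc k) + 1)\<^sup>2 - \<nu>\<^sup>2"
  have q: "?q > 0" by (rule factor_pos)
  have q_eq: "?q = 4 * ((\<mu> + 1/2 + k + 1 - (\<mu> + \<nu>) / 2) * (\<mu> + 1/2 + k + 1 - (\<mu> - \<nu>) / 2))"
    by (simp add: power2_eq_square field_simps)
  have "?q * moment (Suc k) = 4 * ((real k + 1) * (\<mu> + 1/2 + k + 1 - (\<mu> + \<nu>) / 2 - (\<mu> - \<nu>) / 2) * moment k)"
    unfolding q_eq moment_Suc[symmetric] by (rule mult.assoc)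
  also have "\<dots> = (2 * real k + 2) * (2 * real k + 3) * moment k"
    by (simp add: field_simps)
  finally have m: "moment (Suc k) = (2 * real k + 2) * (2 * real k + 3) * moment k / ?q"
    using q by (simp add: field_simps)
  have f: "fact (2 * Suc k + 1) = (2 * real k + 2) * (2 * real k + 3) * fact (2 * k + 1)"
    by (simp add: algebra_simps)
  have "1 / den (Suc k) = 1 / den k / ?q"
    by (simp add: lommel_denominator_def)
  also have "\<dots> = \<kappa> * moment k / fact (2 * k + 1) / ?q" unfolding Suc.IH ..
  also have "\<dots> = \<kappa> * moment (Suc k) / fact (2 * Suc k + 1)"
  proof -
    have "\<kappa> * x / F / y = \<kappa> * (p * x / y) / (p * F)" if "p \<noteq> 0" for x F y p :: real
      using that by simp
    from this[of "(2 * real k + 2) * (2 * real k + 3)"] show ?thesis unfolding m f by auto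
  qed
  finally show ?case .
qed

text \<open>
  The sine-transform representation of the Lommel function.
\<close>
lemma lommel_entire_transform: "z * lommel_entire \<mu> \<nu> z = of_real \<kappa> * transform z"
  and summable_lommel_entire: "summable (\<lambda>k. (-1) ^ k * z ^ (2 * k) / of_real (den k))"
proof -
  have eq: "of_real \<kappa> * ((-1) ^ k * z ^ (2 * k + 1) / fact (2 * k + 1) * of_real (moment k))
     = z * ((-1) ^ k * z ^ (2 * k) / of_real (den k))" for k
  proof -
    have "1 / (of_real (den k) :: complex) = of_real (1 / den k)" by simp
    also have "\<dots> = of_real \<kappa> * of_real (moment k) / fact (2 * k + 1)"
      unfolding reciprocal_den by simp
    finally have inv: "1 / (of_real (den k) :: complex) = of_real \<kappa> * of_real (moment k) / fact (2 * k + 1)" .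
    have "z * ((-1) ^ k * z ^ (2 * k) / of_real (den k)) = (-1) ^ k * z ^ (2 * k + 1) * (1 / of_real (den k))"
      by simp
    also have "\<dots> = of_real \<kappa> * ((-1) ^ k * z ^ (2 * k + 1) / fact (2 * k + 1) * of_real (moment k))"
      unfolding inv by (simp only: times_divide_eq_left times_divide_eq_right mult_ac)
    finally show ?thesis by (rule sym)
  qed
  have S: "(\<lambda>k. z * ((-1) ^ k * z ^ (2 * k) / of_real (den k))) sums (of_real \<kappa> * transform z)"
    using sums_mult[OF transform_sums(2)[of z], of "of_real \<kappa>"] unfolding eq .
  have "summable (\<lambda>k. (-1) ^ k * z ^ (2 * k) / of_real (den k))"
  proof (cases "z = 0")
    case True
    then show ?thesis by (intro summable_finite[of "{0}"]) auto
  next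
    case False
    then show ?thesis using summable_mult[OF sums_summable[OF S], of "inverse z"]
      by (simp add: mult.assoc[symmetric])
  qed
  then show "summable (\<lambda>k. (-1) ^ k * z ^ (2 * k) / of_real (den k))" .
  then show "z * lommel_entire \<mu> \<nu> z = of_real \<kappa> * transform z"
    unfolding lommel_entire_def using S by (simp add: suminf_mult[symmetric] sums_iff)
qed

lemma holomorphic_lommel_entire: "lommel_entire \<mu> \<nu> holomorphic_on UNIV"
proof -
  define Q where "Q w = (\<Sum>k. ((-1) ^ k / of_real (den k)) * w ^ k)" for w :: complex
  have "summable (\<lambda>k. ((-1) ^ k / of_real (den k)) * w ^ k)" for w :: complex
    using summable_lommel_entire[of "csqrt w"] by (simp add: power_mult)
  from termdiffs_strong_converges_everywhere[OF this]
  have "Q holomorphic_on UNIV"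
    unfolding Q_def[abs_def] holomorphic_on_def field_differentiable_def
    by (meson has_field_derivative_at_within)
  then have "(Q \<circ> (\<lambda>z. z\<^sup>2)) holomorphic_on UNIV"
    by (intro holomorphic_on_compose holomorphic_intros) (auto intro: holomorphic_on_subset)
  also have "Q \<circ> (\<lambda>z. z\<^sup>2) = lommel_entire \<mu> \<nu>"
    by (rule ext) (simp add: Q_def lommel_entire_def power_mult)
  finally show ?thesis .
qed

lemma lommel_entire_0: "lommel_entire \<mu> \<nu> 0 = of_real (1 / den 0)"
proof -
  have "(\<lambda>k. (-1) ^ k * (0::complex) ^ (2 * k) / of_real (den k)) sums (\<Sum>k\<in>{0}. (-1) ^ k * 0 ^ (2 * k) / of_real (den k))"
    by (intro sums_finite) auto
  then show ?thesis by (simp add: lommel_entire_def sums_iff)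
qed

text \<open>
  The restriction of \<open>lommel_entire\<close> to the reals; the transform formula degenerates at $0$.
\<close>
definition real_lommel :: "real \<Rightarrow> real" where
  "real_lommel x = (if x = 0 then 1 / den 0 else \<kappa> * real_transform x / x)"

lemma lommel_entire_of_real: "lommel_entire \<mu> \<nu> (of_real x) = of_real (real_lommel x)"
proof (cases "x = 0")
  case True
  then show ?thesis using lommel_entire_0 by (simp add: real_lommel_def)
next
  case False
  then show ?thesis
    using lommel_entire_transform[of "of_real x"] unfolding transform_of_real
    by (simp add: real_lommel_def field_simps)
qed

sublocale alternating_at_multiples_of_pi "lommel_entire \<mu> \<nu>" real_lommel "max (\<kappa> * moment 0) (1 / den 0)"
proof unfold_locales
  fix w :: complex
  show "lommel_entire \<mu> \<nu> (- w) = lommel_entire \<mu> \<nu> w" by (simp add: lommel_entire_def)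
  show "norm (lommel_entire \<mu> \<nu> w) \<le> max (\<kappa> * moment 0) (1 / den 0) * exp \<bar>Im w\<bar>"
  proof (cases "w = 0")
    case True
    then show ?thesis using den_pos[of 0] lommel_entire_0 by (simp add: norm_divide)
  next
    case False
    have "norm w * norm (lommel_entire \<mu> \<nu> w) = \<kappa> * norm (transform w)"
      using arg_cong[OF lommel_entire_transform[of w], of norm] \<kappa>_pos by (simp add: norm_mult)
    also have "\<dots> \<le> \<kappa> * (moment 0 * (norm w * exp \<bar>Im w\<bar>))"
      using \<kappa>_pos by (intro mult_left_mono norm_transform_le) auto
    finally have "norm w * norm (lommel_entire \<mu> \<nu> w) \<le> norm w * (\<kappa> * moment 0 * exp \<bar>Im w\<bar>)"
      by (simp add: mult_ac)
    then have "norm (lommel_entire \<mu> \<nu> w) \<le> \<kappa> * moment 0 * exp \<bar>Im w\<bar>"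
      using False by simp
    also have "\<dots> \<le> max (\<kappa> * moment 0) (1 / den 0) * exp \<bar>Im w\<bar>"
      by (intro mult_right_mono) auto
    finally show ?thesis .
  qed
next
  show "real_lommel 0 > 0" using den_pos by (simp add: real_lommel_def)
next
  fix k
  have "(-1) ^ Suc k * real_transform (real (Suc k) * pi) < 0" by (rule real_transform_sign) simp
  then have "(-1) ^ k * real_transform (real (Suc k) * pi) > 0" by simp
  then have "\<kappa> * ((-1) ^ k * real_transform (real (Suc k) * pi)) / (real (Suc k) * pi) > 0"
    by (intro divide_pos_pos mult_pos_pos[OF \<kappa>_pos]) auto
  moreover have "real (Suc k) * pi \<noteq> 0" by simp
  ultimately show "(-1) ^ k * real_lommel (real (Suc k) * pi) > 0"
    unfolding real_lommel_def by (simp only: if_False times_divide_eq_right mult.left_commute)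
next
  fix y :: real
  \<comment> \<open>On the imaginary axis all terms of the series are non-negative.\<close>
  have "(\<lambda>k. (-1) ^ k * (\<i> * of_real y) ^ (2 * k) / of_real (den k)) = (\<lambda>k. of_real (y ^ (2 * k) / den k))"
  proof
    fix k
    have "(\<i> * complex_of_real y) ^ (2 * k) = (-1) ^ k * of_real (y ^ (2 * k))"
      by (simp add: power_mult power_mult_distrib power_minus[of "(of_real y)\<^sup>2"])
    then have "(-1) ^ k * (\<i> * complex_of_real y) ^ (2 * k) = ((-1) * (-1)) ^ k * of_real (y ^ (2 * k))"
      unfolding power_mult_distrib[of "-1" "-1"] by (simp only: mult.assoc)
    then show "(-1) ^ k * (\<i> * of_real y) ^ (2 * k) / of_real (den k) = complex_of_real (y ^ (2 * k) / den k)"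
      by simp
  qed
  then have eq: "summable (\<lambda>k. complex_of_real (y ^ (2 * k) / den k))"
    "lommel_entire \<mu> \<nu> (\<i> * of_real y) = (\<Sum>k. of_real (y ^ (2 * k) / den k))"
    using summable_lommel_entire[of "\<i> * of_real y"] by (simp_all add: lommel_entire_def)
  then have s: "summable (\<lambda>k. y ^ (2 * k) / den k)" by (subst (asm) summable_complex_of_real)
  have "(\<Sum>k. y ^ (2 * k) / den k) > 0"
    using s by (rule suminf_pos2[of _ 0]) (use den_pos in \<open>auto intro!: divide_nonneg_pos\<close>)
  then show "lommel_entire \<mu> \<nu> (\<i> * of_real y) \<noteq> 0"
    unfolding eq(2) suminf_of_real[OF s, symmetric] by simp
qed (fact holomorphic_lommel_entire lommel_entire_of_real)+

end

lemma lommel_eq: "lommel L \<mu> \<nu> z = exp (of_real (\<mu> + 1) * L z) * lommel_entire \<mu> \<nu> z"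
  by (simp add: lommel_def lommel_entire_def lommel_denominator_def)

lemma lommel_eq_0_iff: "lommel L \<mu> \<nu> z = 0 \<longleftrightarrow> lommel_entire \<mu> \<nu> z = 0"
  by (simp add: lommel_eq)

lemma lommel_entire_abs: "lommel_entire \<mu> \<bar>\<nu>\<bar> = lommel_entire \<mu> \<nu>"
proof -
  have "lommel_denominator \<mu> \<bar>\<nu>\<bar> = lommel_denominator \<mu> \<nu>"
    by (simp add: lommel_denominator_def[abs_def])
  then show ?thesis by (simp add: lommel_entire_def[abs_def])
qed

text \<open>
  The power $z^{\mu+1}$ enters only through a zero-free analytic factor.
\<close>
lemma zorder_exp_times_simple_zero:
  fixes E l :: "complex \<Rightarrow> complex"
  assumes E: "E holomorphic_on UNIV" and "E z = 0" "deriv E z \<noteq> 0" and l: "l analytic_on {z}"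
  shows "zorder (\<lambda>w. exp (l w) * E w) z = 1"
proof (rule zorder_zero_eqI'[where n = 1, simplified])
  have Ez: "E analytic_on {z}" using E analytic_on_open analytic_on_subset by blast
  show "(\<lambda>w. exp (l w) * E w) analytic_on {z}"
    by (intro analytic_intros l Ez)
  show "exp (l z) * E z = 0" using assms by simp
  have "l field_differentiable at z" "E field_differentiable at z"
    using l Ez analytic_on_imp_differentiable_at by auto
  then have "(l has_field_derivative deriv l z) (at z)" "(E has_field_derivative deriv E z) (at z)"
    by (auto simp: DERIV_deriv_iff_field_differentiable)
  then have "((\<lambda>w. exp (l w) * E w) has_field_derivative (exp (l z) * deriv E z)) (at z)"
    using assms by (auto intro!: derivative_eq_intros)
  then show "deriv (\<lambda>w. exp (l w) * E w) z \<noteq> 0" using assms by (simp add: DERIV_imp_deriv)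
qed

theorem corollary3p4:
  fixes \<mu> \<nu> :: real and L :: "complex \<Rightarrow> complex"
  assumes "\<mu> \<in> {-1/2<..<1/2}"
    and "\<bar>\<nu>\<bar> \<in> {\<bar>\<mu>\<bar><..<\<mu> + 1}"
    and "log_choice L"
  shows "(\<forall>z. z \<noteq> 0 \<and> lommel L \<mu> \<nu> z = 0 \<longrightarrow> z \<in> \<real>)
    \<and> (\<forall>z. z \<noteq> 0 \<and> lommel L \<mu> \<nu> z = 0 \<and> L analytic_on {z} \<longrightarrow> zorder (lommel L \<mu> \<nu>) z = 1)
    \<and> {x::real. x \<ge> 0 \<and> x \<noteq> 0 \<and> lommel L \<mu> \<nu> (of_real x) = 0}
        \<subseteq> (\<Union>k\<in>{1::nat..}. {real k * pi<..<(real k + 1) * pi})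
    \<and> (\<forall>k::nat. k \<ge> 1 \<longrightarrow>
         (\<exists>!x::real. x \<in> {real k * pi<..<(real k + 1) * pi} \<and> lommel L \<mu> \<nu> (of_real x) = 0))"
proof -
  interpret lommel_parameters \<mu> "\<bar>\<nu>\<bar>"
    using assms(1,2) by unfold_locales auto
  have zero_iff: "lommel L \<mu> \<nu> z = 0 \<longleftrightarrow> lommel_entire \<mu> \<bar>\<nu>\<bar> z = 0" for z
    by (simp add: lommel_eq_0_iff lommel_entire_abs)
  have real_iff: "lommel L \<mu> \<nu> (of_real x) = 0 \<longleftrightarrow> real_lommel x = 0" for x
    by (simp add: zero_iff lommel_entire_of_real)
  show ?thesis
  proof (intro conjI allI impI subsetI)
    fix z assume "z \<noteq> 0 \<and> lommel L \<mu> \<nu> z = 0"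
    then show "z \<in> \<real>" using zero_real zero_iff by blast
  next
    fix z assume z: "z \<noteq> 0 \<and> lommel L \<mu> \<nu> z = 0 \<and> L analytic_on {z}"
    then have "zorder (\<lambda>w. exp (of_real (\<mu> + 1) * L w) * lommel_entire \<mu> \<bar>\<nu>\<bar> w) z = 1"
      by (intro zorder_exp_times_simple_zero holomorphic_lommel_entire zero_simple_complex analytic_intros)
         (auto simp: zero_iff)
    then show "zorder (lommel L \<mu> \<nu>) z = 1"
      by (simp add: lommel_eq[abs_def] lommel_entire_abs)
  next
    fix x :: real assume "x \<in> {x. x \<ge> 0 \<and> x \<noteq> 0 \<and> lommel L \<mu> \<nu> (of_real x) = 0}"
    then obtain k where "k \<ge> 1" "x \<in> {real k * pi<..<(real k + 1) * pi}"
      using zero_between_multiples_of_pi[of x] by (auto simp: real_iff)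
    then show "x \<in> (\<Union>k\<in>{1::nat..}. {real k * pi<..<(real k + 1) * pi})" by auto
  next
    fix k :: nat assume k: "k \<ge> 1"
    show "\<exists>!x. x \<in> {real k * pi<..<(real k + 1) * pi} \<and> lommel L \<mu> \<nu> (of_real x) = 0"
      unfolding real_iff using ex_zero_between[OF k] at_most_one_zero_between[of _ k] by blast
  qed
qed

end
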